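(* For the random connection model described in the context, the coefficients $q_n(x):=q_n(x,0)$, $n\in\mathbb{N}_0$, of the series representation of $Q_t$ at $t_0=0$ satisfy $$q_n(x)=\frac1{n!}\sum_{H\in\mathbb{G}_n^0}\kappa_n(H)\,J_n(H,x),\quad x\in\mathbb{R}^d .$$
   Context: Random connection model. $\varphi:\mathbb{R}^d\to[0,1]$ is measurable with $\varphi(x)=\varphi(-x)$ and $0<m_\varphi:=\int\varphi(x)\,dx<\infty$. For $t\ge0$, $\eta_t$ is a stationary Poisson process on $\mathbb{R}^d$ with intensity $t$; for $t>0$ write $\eta_t=\{X_i:i\in\mathbb{N}\}$ with a.s. distinct $X_i$, and $\eta_0=\emptyset$. $\mathbb{R}^{[2d]}$ is the space of two-element subsets of $\mathbb{R}^d$; $<$ is the strict lexicographic order on $\mathbb{R}^d$. For points $y_1,\dots,y_k\in\mathbb{R}^d$ let $(Z_i)_{i\in I}$ be the family consisting of $y_1,\dots,y_k$ and (if $t>0$) the $X_j$, and let $\chi_t^{y_1,\dots,y_k}:=\{(\{Z_i,Z_j\},U_{i,j}):i,j\in I,\ Z_i<Z_j\}$ with independent marks $U_{i,j}$, uniform on $[0,1]$ and independent of $\eta_t$; when the added points vary over subfamilies of a fixed finite family the same marks are used for the same pairs of indices. For a point process $\tilde\chi$ on $\mathbb{R}^{[2d]}\times[0,1]$, $\mathcal{G}(\tilde\chi)$ is the graph whose vertices are the endpoints of those $e$ with $\tilde\chi(\{e\}\times[0,1])=1$ and in which $e=\{x,y\}$ is an edge iff $\tilde\chi(\{(e,u)\})=1$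 for some $u\le\varphi(y-x)$. $C(x,\tilde\chi)$ is the (vertex set of the) connected component of $x$, and $\{x\}$ if $x$ is not a vertex. $P_t(x):=\mathbb{P}(x\in C(0,\chi_t^{0,x}))$, and $Q_t$ is the unique function in $L^1\cap L^\infty$ (integrable bounded functions) with $P_t=Q_t+t\,Q_t\ast P_t$, where $(f\ast g)(x)=\int f(x-y)g(y)\,dy$; it exists for $t<t_c:=\sup\{t\ge0:\mathbb{P}(|C(0,\chi_t^0)|=\infty)=0\}$. With $[n]:=\{1,\dots,n\}$ and $\mathbf{x}_J:=(x_i)_{i\in J}$, put $p_0(x):=P_0(x)$ and $p_n(x):=\frac1{n!}\int_{(\mathbb{R}^d)^n}\mathbb{E}\sum_{J\subset[n]}(-1)^{n-|J|}\mathbf{1}\{x\in C(0,\chi_0^{0,\mathbf{x}_J,x})\}\,d\mathbf{x}$, $n\ge1$. For $t\ge0$ near $0$ one has $Q_t=\sum_{n\ge0}t^nq_n$ in $L^1$ and $L^\infty$, where the coefficients $q_n=q_n(\cdot,0)$ are determined by $q_0=p_0$ and $q_n=p_n-\sum_{k=1}^nq_{n-k}\ast p_{k-1}$, $n\ge1$. Combinatorics. For $n\in\mathbb{N}_0$, $\mathbb{G}_n$ is the set of connected (simple) graphs $G=(V(G),E(G))$ with vertex set $\{0,\dots,n+1\}$. For $I\subset[n]$, "$i\leftrightarrow j$ in $G|I$" means that $G$ contains a path from $i$ to $j$ using only vertices in $I\cup\{i,j\}$. Define $$\pi_n(G):=\sum_{I\subset[n]}(-1)^{n-|I|}\mathbf{1}\{0\leftrightarrow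 n+1\text{ in }G|I\},\qquad \kappa_n(H):=\sum_{G\in\mathbb{G}_n,\ E(G)\subset E(H)}\pi_n(G)(-1)^{|E(H)|-|E(G)|},$$ $$J_n(G,x):=\int_{(\mathbb{R}^d)^n}\prod_{\{i,j\}\in E(G)}\varphi(x_i-x_j)\,d(x_1,\dots,x_n),\quad x_0:=0,\ x_{n+1}:=x$$ (no integration for $n=0$). A vertex $i\in[n]$ of $G\in\mathbb{G}_n$ is pivotal if every path from $0$ to $n+1$ in $G$ contains $i$. $\mathbb{G}_n^0\subset\mathbb{G}_n$ is the set of graphs without pivotal vertex.
   Formalization: The point x = 0 is excluded unless φ(0) = 1: since 0 always lies in C(0,·), q_0(0) = P_0(0) = 1, whereas the right-hand side for n = 0 at x = 0 is φ(0), so the formula fails there when φ(0) < 1. *)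

theory Defs
  imports "HOL-Probability.Probability"
begin

subsection \<open>Paths\<close>

definition is_path :: "'a set set \<Rightarrow> 'a \<Rightarrow> 'a list \<Rightarrow> 'a \<Rightarrow> bool" where
  "is_path E u p v \<longleftrightarrow>
     p \<noteq> [] \<and> hd p = u \<and> last p = v \<and> distinct p \<and> successively (\<lambda>a b. {a, b} \<in> E) p"


subsection \<open>The random connection model at intensity zero\<close>

text \<open>
  The space of dimension \<open>d\<close> is \<^typ>\<open>real ^ 'd\<close>, with a linear order on the index type so that
  the lexicographic order makes sense. (The library order on this type is componentwise.)
\<close>

definition lex_less :: "real ^ 'd::{finite,linorder} \<Rightarrow> real ^ 'd::{finite,linorder} \<Rightarrow> bool" where
  "lex_less x y \<longleftrightarrow> (\<exists>i. x $ i < y $ i \<and> (\<forall>j<i. x $ j = y $ j))"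

text \<open>
  A point process on (two-element sets) \<open>\<times>\<close> [0,1] is represented by its set of atoms; the number of
  points in \<open>B\<close> is then \<open>card (\<xi> \<inter> B)\<close>.
\<close>

definition marked_pairs ::
  "'i set \<Rightarrow> ('i \<Rightarrow> real ^ 'd::{finite,linorder}) \<Rightarrow> ('i \<times> 'i \<Rightarrow> real) \<Rightarrow>
     ((real ^ 'd::{finite,linorder}) set \<times> real) set"
where
  "marked_pairs I Z U = {({Z i, Z j}, U (i, j)) | i j. i \<in> I \<and> j \<in> I \<and> lex_less (Z i) (Z j)}"

definition rcm_vertices :: "('a set \<times> real) set \<Rightarrow> 'a set" where
  "rcm_vertices \<xi> = \<Union> {e. card (\<xi> \<inter> ({e} \<times> {0..1})) = 1}"

definition rcm_edges ::
  "('a::ab_group_add \<Rightarrow> real) \<Rightarrow> ('a set \<times> real) set \<Rightarrow> 'a set set" where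
  "rcm_edges \<phi> \<xi> = {{y, z} | y z. y \<noteq> z \<and> y \<in> rcm_vertices \<xi> \<and> z \<in> rcm_vertices \<xi> \<and>
     (\<exists>u\<in>{0..1}. card (\<xi> \<inter> {({y, z}, u)}) = 1 \<and> u \<le> \<phi> (z - y))}"

definition rcm_component ::
  "('a::ab_group_add \<Rightarrow> real) \<Rightarrow> 'a \<Rightarrow> ('a set \<times> real) set \<Rightarrow> 'a set" where
  "rcm_component \<phi> x \<xi> =
     (if x \<in> rcm_vertices \<xi> then {y. \<exists>p. is_path (rcm_edges \<phi> \<xi>) x p y} else {x})"

text \<open>The points \<open>x\<^sub>0 = 0\<close>, \<open>x\<^sub>1, \<dots>, x\<^sub>n\<close>, \<open>x\<^sub>n\<^sub>+\<^sub>1 = x\<close>.\<close>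

definition pts :: "nat \<Rightarrow> (nat \<Rightarrow> 'a::zero) \<Rightarrow> 'a \<Rightarrow> nat \<Rightarrow> 'a" where
  "pts n xs x = xs(0 := 0, n + 1 := x)"

definition mark_space :: "nat \<Rightarrow> (nat \<times> nat \<Rightarrow> real) measure" where
  "mark_space n = (\<Pi>\<^sub>M ij\<in>{0..n+1} \<times> {0..n+1}. uniform_measure lborel {0..1})"

text \<open>
  The event that \<open>x\<close> lies in the component of 0 when the added points are \<open>0\<close>, the \<open>x\<^sub>i\<close> with
  \<open>i \<in> J\<close>, and \<open>x\<close>; at intensity zero there are no further points.
\<close>

definition connects ::
  "(real ^ 'd::{finite,linorder} \<Rightarrow> real) \<Rightarrow> nat \<Rightarrow> nat set \<Rightarrow>
     (nat \<Rightarrow> real ^ 'd::{finite,linorder}) \<Rightarrow> real ^ 'd::{finite,linorder} \<Rightarrow> (nat \<times> nat \<Rightarrow> real) \<Rightarrow> bool" where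
  "connects \<phi> n J xs x U \<longleftrightarrow>
     x \<in> rcm_component \<phi> 0 (marked_pairs ({0} \<union> J \<union> {n+1}) (pts n xs x) U)"

definition P0 :: "(real ^ 'd::{finite,linorder} \<Rightarrow> real) \<Rightarrow> real ^ 'd::{finite,linorder} \<Rightarrow> real" where
  "P0 \<phi> x = \<P>(U in mark_space 0. connects \<phi> 0 {} (\<lambda>_. 0) x U)"

definition p_coeff ::
  "(real ^ 'd::{finite,linorder} \<Rightarrow> real) \<Rightarrow> nat \<Rightarrow> real ^ 'd::{finite,linorder} \<Rightarrow> real" where
  "p_coeff \<phi> n x =
     (if n = 0 then P0 \<phi> x
      else 1 / fact n *
        (\<integral>xs. (\<integral>U. (\<Sum>J\<in>Pow {1..n}. (-1) ^ (n - card J) * of_bool (connects \<phi> n J xs x U))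
                 \<partial>mark_space n)
           \<partial>(\<Pi>\<^sub>M i\<in>{1..n}. lborel)))"

definition convolution ::
  "('a::euclidean_space \<Rightarrow> real) \<Rightarrow> ('a \<Rightarrow> real) \<Rightarrow> 'a \<Rightarrow> real" where
  "convolution f g x = (\<integral>y. f (x - y) * g y \<partial>lborel)"

text \<open>
  The coefficients of the expansion \<open>Q\<^sub>t = (\<Sum>n. t\<^sup>n q\<^sub>n)\<close> at \<open>t = 0\<close>, obtained by comparing
  coefficients in \<open>P\<^sub>t = Q\<^sub>t + t Q\<^sub>t \<star> P\<^sub>t\<close>.
  At the single point \<open>x = 0\<close> the component of 0 contains \<open>x\<close> for trivial reasons, so that
  \<open>q\<^sub>0(0) = 1\<close> and not \<open>\<phi>(0)\<close>.
\<close>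

fun q_coeff ::
  "(real ^ 'd::{finite,linorder} \<Rightarrow> real) \<Rightarrow> nat \<Rightarrow> real ^ 'd::{finite,linorder} \<Rightarrow> real" where
  "q_coeff \<phi> 0 = p_coeff \<phi> 0"
| "q_coeff \<phi> (Suc m) =
     (\<lambda>x. p_coeff \<phi> (Suc m) x -
          (\<Sum>k=1..Suc m. convolution (q_coeff \<phi> (Suc m - k)) (p_coeff \<phi> (k - 1)) x))"


subsection \<open>Graphs on \<open>{0, \<dots>, n+1}\<close>\<close>

text \<open>As the vertex set is fixed, a graph is identified with its set of edges.\<close>

definition conn_graphs :: "nat \<Rightarrow> nat set set set" where
  "conn_graphs n = {E. E \<subseteq> {e. e \<subseteq> {0..n+1} \<and> card e = 2} \<and>
     (\<forall>i\<in>{0..n+1}. \<forall>j\<in>{0..n+1}. \<exists>p. is_path E i p j)}"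

definition connected_within :: "nat set set \<Rightarrow> nat set \<Rightarrow> nat \<Rightarrow> nat \<Rightarrow> bool" where
  "connected_within E I i j \<longleftrightarrow> (\<exists>p. is_path E i p j \<and> set p \<subseteq> I \<union> {i, j})"

definition pi_coeff :: "nat \<Rightarrow> nat set set \<Rightarrow> int" where
  "pi_coeff n G =
     (\<Sum>I\<in>Pow {1..n}. (-1) ^ (n - card I) * of_bool (connected_within G I 0 (n+1)))"

definition kappa_coeff :: "nat \<Rightarrow> nat set set \<Rightarrow> int" where
  "kappa_coeff n H =
     (\<Sum>G\<in>{G \<in> conn_graphs n. G \<subseteq> H}. pi_coeff n G * (-1) ^ (card H - card G))"

definition J_int ::
  "('a::euclidean_space \<Rightarrow> real) \<Rightarrow> nat \<Rightarrow> nat set set \<Rightarrow> 'a \<Rightarrow> real" where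
  "J_int \<phi> n G x =
     (\<integral>xs. (\<Prod>(i, j)\<in>{(i, j). i < j \<and> {i, j} \<in> G}. \<phi> (pts n xs x i - pts n xs x j))
        \<partial>(\<Pi>\<^sub>M i\<in>{1..n}. lborel))"

definition pivotal :: "nat \<Rightarrow> nat set set \<Rightarrow> nat \<Rightarrow> bool" where
  "pivotal n G i \<longleftrightarrow> i \<in> {1..n} \<and> (\<forall>p. is_path G 0 p (n+1) \<longrightarrow> i \<in> set p)"

definition conn_graphs_no_pivotal :: "nat \<Rightarrow> nat set set set" where
  "conn_graphs_no_pivotal n = {G \<in> conn_graphs n. \<not> (\<exists>i. pivotal n G i)}"

end

theory Submission
  imports Defs
begin

text \<open>
  Both sides of the identity are read off from one expansion of the connection probabilities in
  products of edge weights; this expansion is then cut at the last pivotal vertex.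

  Fix distinct points \<open>x\<^sub>0 = 0, x\<^sub>1, \<dots>, x\<^sub>n, x\<^sub>n\<^sub>+\<^sub>1 = x\<close>. The model without further points is a
  random graph \<open>G\<close> on the indices in which the edges \<open>{i, j}\<close> are present independently with
  probability \<open>\<phi> (x\<^sub>i - x\<^sub>j)\<close>, and the alternating sum over \<open>J\<close> in the definition of \<open>p\<^sub>n\<close> is
  \<open>\<pi>\<^sub>n(G)\<close>. As \<open>\<kappa>\<^sub>n\<close> is the Moebius transform of \<open>\<pi>\<^sub>n\<close>, one has \<open>\<pi>\<^sub>n(G) = \<Sum>H\<subseteq>G. \<kappa>\<^sub>n(H)\<close>. Taking
  expectations replaces the indicator of \<open>H \<subseteq> G\<close> by the product of the edge weights of \<open>H\<close>, so
  \<open>n! p\<^sub>n\<close> is the sum of \<open>\<kappa>\<^sub>n(H) J\<^sub>n(H, x)\<close> over all connected graphs \<open>H\<close>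
  (\<open>p_coeff_eq_graph_coeff\<close>).

  It remains to see that the sum over the graphs without pivotal vertex satisfies the recursion that
  defines \<open>q\<^sub>n\<close>. The key is that \<open>\<pi>\<close>, and hence \<open>\<kappa>\<close>, vanishes on graphs in which the presence of some
  vertex does not matter for the connection: on disconnected graphs, and on graphs in which deleting
  a vertex \<open>v\<close> separates some vertex from both end points (\<open>pi_on_nonzero_connected\<close>,
  \<open>pi_on_nonzero_no_dangling\<close>). So if \<open>\<kappa>(H) \<noteq> 0\<close> and \<open>v\<close> is pivotal, then \<open>H\<close> is the union of two
  graphs that share only \<open>v\<close>: one joins \<open>0\<close> to \<open>v\<close>, the other joins \<open>v\<close> to \<open>n + 1\<close>. The two
  graphs are determined by \<open>H\<close> and \<open>v\<close>. Here \<open>\<kappa>\<close> is multiplicative (\<open>kappa_on_glue\<close>), and \<open>v\<close> is the last pivotal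
  vertex of \<open>H\<close> exactly if the second graph has no pivotal vertex. This gives an identity between
  polynomials in the edge weights (\<open>graph_sum_decompose\<close>). Integration turns it into
  convolutions (\<open>graph_coeff_decompose\<close>), where the factor \<open>n!\<close> absorbs the number of choices of
  \<open>v\<close> and of the vertex sets of the two parts; this is the recursion of \<open>q\<^sub>n\<close>
  (\<open>q_coeff_eq_graph_coeff\<close>).

  Splitting the integrals requires that they converge absolutely: a connected graph contains a tree,
  its remaining edge weights are at most \<open>1\<close>, and the tree can be integrated leaf by leaf
  (\<open>integrable_connected\<close>).
\<close>

section \<open>Reachability within a set of vertices\<close>

text \<open>
  Reflexive transitive closure instead of paths: walks compose without any care for repeated
  vertices. In particular \<open>reach E S u u\<close> holds for \<open>u\<close> outside \<open>S\<close> too.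
\<close>
definition reach :: "'a set set \<Rightarrow> 'a set \<Rightarrow> 'a \<Rightarrow> 'a \<Rightarrow> bool" where
  "reach E S = (\<lambda>x y. {x, y} \<in> E \<and> x \<in> S \<and> y \<in> S)\<^sup>*\<^sup>*"

lemma reach_refl [simp]: "reach E S u u"
  by (simp add: reach_def)

lemma reach_trans: "reach E S u v \<Longrightarrow> reach E S v w \<Longrightarrow> reach E S u w"
  by (simp add: reach_def)

lemma reach_sym: "reach E S u v \<Longrightarrow> reach E S v u"
  unfolding reach_def
  by (rule sympD[OF symp_rtranclp]) (auto intro!: sympI simp: insert_commute)

lemma reach_edge: "{u, v} \<in> E \<Longrightarrow> u \<in> S \<Longrightarrow> v \<in> S \<Longrightarrow> reach E S u v"
  by (auto simp: reach_def)

lemma reach_mono: "reach E S u v \<Longrightarrow> E \<subseteq> E' \<Longrightarrow> S \<subseteq> S' \<Longrightarrow> reach E' S' u v"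
  unfolding reach_def
  by (rule rtranclp_mono[THEN predicate2D, of "\<lambda>x y. {x, y} \<in> E \<and> x \<in> S \<and> y \<in> S"]) auto

lemma reach_induct [consumes 1, case_names base step]:
  assumes "reach E S u v" and "P u"
    and "\<And>x y. reach E S u x \<Longrightarrow> {x, y} \<in> E \<Longrightarrow> x \<in> S \<Longrightarrow> y \<in> S \<Longrightarrow> P x \<Longrightarrow> P y"
  shows "P v"
  using assms(1) unfolding reach_def
proof (induction rule: rtranclp_induct)
  case (step x y)
  then show ?case using assms(3)[of x y] by (simp add: reach_def)
qed (rule assms(2))

lemma reach_in: "reach E S u v \<Longrightarrow> u \<noteq> v \<Longrightarrow> u \<in> S \<and> v \<in> S"
  by (induction rule: reach_induct) auto

text \<open>
  The tool for all separation arguments: a set that no admissible edge leaves confines the walk,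
  and the walk survives in every edge set \<open>E'\<close> that contains the edges met on the way.
\<close>
lemma reach_closed:
  assumes "reach E S u v" and "u \<in> C"
    and "\<And>x y. x \<in> C \<Longrightarrow> {x, y} \<in> E \<Longrightarrow> x \<in> S \<Longrightarrow> y \<in> S \<Longrightarrow> y \<in> C \<and> {x, y} \<in> E'"
  shows "v \<in> C \<and> reach E' (S \<inter> C) u v"
  using assms(1,2)
proof (induction rule: reach_induct)
  case (step x y)
  then have "x \<in> C" "y \<in> C" "{x, y} \<in> E'" using assms(3)[of x y] by auto
  moreover from this have "reach E' (S \<inter> C) x y" using step by (intro reach_edge) auto
  ultimately show ?case using step by (blast intro: reach_trans)
qed simp

lemma reach_image:
  assumes inj: "inj_on f S" and E: "\<And>e. e \<in> E \<Longrightarrow> e \<subseteq> S" and uv: "u \<in> S" "v \<in> S"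
  shows "reach ((`) f ` E) (f ` S) (f u) (f v) \<longleftrightarrow> reach E S u v"
proof
  assume "reach E S u v"
  then show "reach ((`) f ` E) (f ` S) (f u) (f v)"
  proof (induction rule: reach_induct)
    case (step x y)
    have "f ` {x, y} \<in> (`) f ` E" using step by blast
    then have "reach ((`) f ` E) (f ` S) (f x) (f y)" using step by (auto intro: reach_edge)
    with step show ?case by (blast intro: reach_trans)
  qed simp
next
  assume "reach ((`) f ` E) (f ` S) (f u) (f v)"
  have "reach E S u y" if "reach ((`) f ` E) (f ` S) (f u) w" "y \<in> S" "f y = w" for w y
    using that
  proof (induction arbitrary: y rule: reach_induct)
    case base
    then show ?case using inj_onD[OF inj, of y u] uv by simp
  next
    case (step x w)
    from step(2) obtain e where e: "e \<in> E" "{x, w} = f ` e" by blast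
    from step(3) obtain x' where x': "x' \<in> S" "f x' = x" by blast
    have "f ` e = f ` {x', y}" using e x' step.prems by simp
    then have "e = {x', y}"
      using inj_on_image_eq_iff[OF inj E[OF e(1)], of "{x', y}"] x' step.prems by simp
    then have "reach E S x' y" using e x' step.prems by (simp add: reach_edge)
    with step.IH[OF x'] show "reach E S u y" by (rule reach_trans)
  qed
  from this[OF \<open>reach ((`) f ` E) (f ` S) (f u) (f v)\<close> uv(2) refl] show "reach E S u v" .
qed

lemma reach_restrict_edges: "reach {e \<in> E. e \<subseteq> S} S u v \<longleftrightarrow> reach E S u v"
  unfolding reach_def by (rule arg_cong[where f = "\<lambda>R. R\<^sup>*\<^sup>* u v"]) auto

lemma is_path_imp_reach:
  assumes "is_path E u p v" "set p \<subseteq> S"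
  shows "reach E S u v"
  using assms
proof (induction p arbitrary: u)
  case (Cons x p)
  show ?case
  proof (cases p)
    case Nil
    then show ?thesis using Cons by (auto simp: is_path_def)
  next
    case (Cons y q)
    have "reach E S y v"
      using Cons.IH[of y] Cons.prems Cons by (auto simp: is_path_def)
    moreover have "{u, y} \<in> E" "u \<in> S" "y \<in> S"
      using Cons.prems Cons by (auto simp: is_path_def)
    ultimately show ?thesis by (blast intro: reach_trans reach_edge)
  qed
qed (simp add: is_path_def)

text \<open>
  A walk that returns to a visited vertex is cut back to its first visit, which keeps the path simple.
\<close>
lemma reach_imp_is_path:
  assumes "reach E S u v" "u \<in> S"
  shows "\<exists>p. is_path E u p v \<and> set p \<subseteq> S"
  using assms
proof (induction rule: reach_induct)
  case base
  have "is_path E u [u] u" by (simp add: is_path_def)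
  then show ?case using base by (intro exI[of _ "[u]"]) auto
next
  case (step x y)
  then obtain p where p: "is_path E u p x" "set p \<subseteq> S" by blast
  show ?case
  proof (cases "y \<in> set p")
    case True
    then obtain q r where "p = q @ y # r" by (auto dest: split_list)
    with p have "is_path E u (q @ [y]) y" "set (q @ [y]) \<subseteq> S"
      by (auto simp: is_path_def successively_append_iff hd_append)
    then show ?thesis by blast
  next
    case False
    with p step have "is_path E u (p @ [y]) y" "set (p @ [y]) \<subseteq> S"
      by (auto simp: is_path_def successively_append_iff hd_append)
    then show ?thesis by blast
  qed
qed

section \<open>The coefficients for arbitrary vertex sets\<close>

text \<open>
  Cutting a graph at a vertex produces graphs on arbitrary vertex sets with arbitrary end points.
  Therefore \<open>\<pi>\<close>, \<open>\<kappa>\<close> and the absence of pivotal vertices are considered for a set \<open>V\<close> of inner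
  vertices and end points \<open>a\<close>, \<open>b\<close>; the vertex set of the graph is \<open>V \<union> {a, b}\<close>.
\<close>
definition edges_on :: "'a set \<Rightarrow> 'a set set" where
  "edges_on W = {e. e \<subseteq> W \<and> card e = 2}"

lemma edges_on_mono: "W \<subseteq> W' \<Longrightarrow> edges_on W \<subseteq> edges_on W'"
  by (auto simp: edges_on_def)

lemma finite_edges_on: "finite W \<Longrightarrow> finite (edges_on W)"
  by (rule finite_subset[of _ "Pow W"]) (auto simp: edges_on_def)

lemma doubleton_edges_on: "{x, y} \<in> edges_on W \<longleftrightarrow> x \<in> W \<and> y \<in> W \<and> x \<noteq> y"
  by (auto simp: edges_on_def card_insert_if)

lemma edges_onE: assumes "e \<in> edges_on W" obtains x y where "e = {x, y}" "x \<in> W" "y \<in> W" "x \<noteq> y"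
  using assms by (auto simp: edges_on_def card_2_iff)

definition pi_on :: "'a set \<Rightarrow> 'a \<Rightarrow> 'a \<Rightarrow> 'a set set \<Rightarrow> int" where
  "pi_on V a b G = (\<Sum>I\<in>Pow V. (-1) ^ (card V - card I) * of_bool (reach G (I \<union> {a, b}) a b))"

text \<open>
  The sum runs over all subgraphs and not only over the connected ones: \<open>pi_on\<close> vanishes on the others.
\<close>
definition kappa_on :: "'a set \<Rightarrow> 'a \<Rightarrow> 'a \<Rightarrow> 'a set set \<Rightarrow> int" where
  "kappa_on V a b H = (\<Sum>G\<in>Pow H. pi_on V a b G * (-1) ^ (card H - card G))"

definition no_pivotal :: "'a set \<Rightarrow> 'a \<Rightarrow> 'a \<Rightarrow> 'a set set \<Rightarrow> bool" where
  "no_pivotal V a b H \<longleftrightarrow> (\<forall>v\<in>V. reach H (V \<union> {a, b} - {v}) a b)"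

lemma sum_Pow_card:
  assumes "finite S"
  shows "(\<Sum>A\<in>Pow S. f (card A)) = (\<Sum>j\<le>card S. of_nat (card S choose j) * (f j :: real))"
proof -
  have "(\<Sum>A\<in>Pow S. f (card A)) = (\<Sum>j\<le>card S. \<Sum>A\<in>{A \<in> Pow S. card A = j}. f (card A))"
    using assms by (intro sum.group[symmetric]) (auto intro: card_mono)
  also have "\<dots> = (\<Sum>j\<le>card S. of_nat (card S choose j) * f j)"
    using assms by (intro sum.cong refl) (simp add: n_subsets flip: Pow_def)
  finally show ?thesis .
qed

lemma sum_Pow_insert:
  assumes "finite S" "v \<notin> S"
  shows "(\<Sum>I\<in>Pow (insert v S). f I) = (\<Sum>I\<in>Pow S. f I + f (insert v I))"
proof -
  have "inj_on (insert v) (Pow S)" using assms by (auto simp: inj_on_def)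
  moreover have "Pow S \<inter> insert v ` Pow S = {}" using assms by auto
  ultimately show ?thesis
    using assms by (simp add: Pow_insert sum.union_disjoint sum.reindex sum.distrib)
qed

lemma sum_Pow_Un:
  assumes "A \<inter> B = {}"
  shows "(\<Sum>I\<in>Pow (A \<union> B). f I) = (\<Sum>X\<in>Pow A. \<Sum>Y\<in>Pow B. f (X \<union> Y))"
proof -
  have "bij_betw (\<lambda>(X, Y). X \<union> Y) (Pow A \<times> Pow B) (Pow (A \<union> B))"
    using assms
    by (intro bij_betwI[where g = "\<lambda>I. (I \<inter> A, I \<inter> B)"]) auto
  from sum.reindex_bij_betw[OF this, of f] show ?thesis
    by (simp add: sum.cartesian_product split_def)
qed

text \<open>
  If \<open>v\<close> is irrelevant for the connection, the sets with and without \<open>v\<close> cancel in pairs.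
\<close>
lemma pi_on_eq_0_toggle:
  assumes "finite V" "v \<in> V"
    and eq: "\<And>I. I \<subseteq> V \<Longrightarrow> reach G (insert v I \<union> {a, b}) a b \<Longrightarrow> reach G (I \<union> {a, b}) a b"
  shows "pi_on V a b G = 0"
proof -
  define S where "S = V - {v}"
  have S: "V = insert v S" "finite S" "v \<notin> S" using assms by (auto simp: S_def)
  have "(-1 :: int) ^ (card V - card I) * of_bool (reach G (I \<union> {a, b}) a b) +
     (-1) ^ (card V - card (insert v I)) * of_bool (reach G (insert v I \<union> {a, b}) a b) = 0"
    if "I \<in> Pow S" for I
  proof -
    have I: "I \<subseteq> V" "finite I" "v \<notin> I" "card I \<le> card S"
      using that S by (auto intro: finite_subset card_mono)
    have "reach G (insert v I \<union> {a, b}) a b \<longleftrightarrow> reach G (I \<union> {a, b}) a b"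
      using eq[OF I(1)] by (auto elim: reach_mono)
    moreover have "card V - card I = Suc (card V - card (insert v I))"
      using S I by (simp add: Suc_diff_le)
    ultimately show ?thesis by simp
  qed
  then show ?thesis
    unfolding pi_on_def by (subst (1) S(1), subst sum_Pow_insert[OF S(2,3)], intro sum.neutral ballI)
qed

text \<open>
  A vertex that cannot be reached from \<open>a\<close> is never used by a walk from \<open>a\<close> to \<open>b\<close>.
\<close>
lemma pi_on_nonzero_connected:
  assumes "finite V" "pi_on V a b G \<noteq> 0" "u \<in> insert b V"
  shows "reach G (V \<union> {a, b}) a u"
proof (rule ccontr)
  assume not: "\<not> reach G (V \<union> {a, b}) a u"
  show False
  proof (cases "u = b")
    case True
    then have "\<not> reach G (I \<union> {a, b}) a b" if "I \<subseteq> V" for I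
      using not that reach_mono[of G "I \<union> {a, b}" a b G "V \<union> {a, b}"] True by blast
    then have "pi_on V a b G = 0" unfolding pi_on_def by (intro sum.neutral) auto
    with assms show False by simp
  next
    case False
    with assms have u: "u \<in> V" by simp
    have "pi_on V a b G = 0"
    proof (rule pi_on_eq_0_toggle[OF assms(1) u])
      fix I assume I: "I \<subseteq> V" and r: "reach G (insert u I \<union> {a, b}) a b"
      let ?C = "{y. reach G (V \<union> {a, b}) a y}"
      have "reach G ((insert u I \<union> {a, b}) \<inter> ?C) a b"
        by (rule reach_closed[OF r, THEN conjunct2])
          (use I u in \<open>auto intro: reach_trans reach_edge\<close>)
      then show "reach G (I \<union> {a, b}) a b"
        by (rule reach_mono) (use not in auto)
    qed
    with assms show False by simp
  qed
qed

text \<open>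
  A part of the graph that is attached only through \<open>v\<close> is irrelevant: a walk from \<open>a\<close> to \<open>b\<close> that
  enters it must come back to \<open>v\<close>, and the excursion can be omitted.
\<close>
lemma pi_on_nonzero_no_dangling:
  assumes "finite V" "pi_on V a b G \<noteq> 0" "v \<in> V" "u \<in> V" "u \<noteq> v" "a \<notin> V" "b \<notin> V"
  shows "reach G (V \<union> {a, b} - {v}) a u \<or> reach G (V \<union> {a, b} - {v}) b u"
proof (rule ccontr)
  assume not: "\<not> ?thesis"
  define W where "W = V \<union> {a, b}"
  \<comment> \<open>The part that hangs on \<open>v\<close>: it is entered and left only through \<open>v\<close>.\<close>
  define C where "C = {y. reach G (W - {v}) u y}"
  have C: "u \<in> C" "a \<notin> C" "b \<notin> C" "v \<notin> C"
    using not assms reach_in[of G "W - {v}" u v] by (auto simp: C_def W_def dest: reach_sym)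
  have C_step: "x \<in> C \<longleftrightarrow> y \<in> C"
    if "{x, y} \<in> G" "x \<in> W" "y \<in> W" "x \<noteq> v" "y \<noteq> v" for x y
    using that unfolding C_def
    by (auto intro: reach_trans[OF _ reach_edge] simp: insert_commute)
  have "pi_on V a b G = 0"
  proof (rule pi_on_eq_0_toggle[OF assms(1) assms(4)])
    fix I assume I: "I \<subseteq> V" and r: "reach G (insert u I \<union> {a, b}) a b"
    define S where "S = I \<union> {a, b}"
    have S: "insert u S \<subseteq> W" "a \<in> S" using I assms by (auto simp: W_def S_def)
    \<comment> \<open>While the walk is inside \<open>C\<close>, the shortened walk waits at \<open>v\<close>.\<close>
    have "(z \<notin> C \<longrightarrow> reach G S a z) \<and> (z \<in> C \<longrightarrow> reach G S a v)"
      if "reach G (insert u S) a z" for z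
      using that
    proof (induction rule: reach_induct)
      case (step x y)
      then have xy: "x \<in> W" "y \<in> W" using S by auto
      show ?case
      proof (cases "x \<in> C")
        case True
        have "reach G S a v" using step True by simp
        moreover have "y = v" if "y \<notin> C" using C_step[OF step(2) xy] True that C by auto
        ultimately show ?thesis by auto
      next
        case False
        then have x: "reach G S a x" "x \<in> S" using step C by auto
        show ?thesis
        proof (cases "y \<in> C")
          case True
          then have "x = v" using C_step[OF step(2) xy] False C by auto
          then show ?thesis using True x by simp
        next
          case y: False
          then have "y \<in> S" using step C by auto
          then have "reach G S a y" using x step(2) by (blast intro: reach_trans reach_edge)
          then show ?thesis using y by simp
        qed
      qed
    qed (use C in simp)
    from this[of b] show "reach G (I \<union> {a, b}) a b" using C r by (simp add: S_def insert_commute)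
  qed
  with assms show False by simp
qed

lemma kappa_on_nonzeroE:
  assumes "kappa_on V a b H \<noteq> 0"
  obtains G where "G \<subseteq> H" "pi_on V a b G \<noteq> 0"
proof -
  from assms obtain G where "G \<in> Pow H" "pi_on V a b G * (-1) ^ (card H - card G) \<noteq> 0"
    unfolding kappa_on_def by (rule sum.not_neutral_contains_not_neutral)
  then show ?thesis using that by auto
qed

text \<open>
  Reachability is monotone in the edges, so both properties pass from a subgraph with
  \<open>\<pi> \<noteq> 0\<close> to the whole graph.
\<close>
lemma kappa_on_nonzero_connected:
  assumes "finite V" "kappa_on V a b H \<noteq> 0" "u \<in> insert b V"
  shows "reach H (V \<union> {a, b}) a u"
  using assms(2)
proof (rule kappa_on_nonzeroE)
  fix G assume G: "G \<subseteq> H" "pi_on V a b G \<noteq> 0"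
  show ?thesis
    by (rule reach_mono[OF pi_on_nonzero_connected[OF assms(1) G(2) assms(3)] G(1) order_refl])
qed

lemma kappa_on_nonzero_no_dangling:
  assumes "finite V" "kappa_on V a b H \<noteq> 0" "v \<in> V" "u \<in> V" "u \<noteq> v" "a \<notin> V" "b \<notin> V"
  shows "reach H (V \<union> {a, b} - {v}) a u \<or> reach H (V \<union> {a, b} - {v}) b u"
  using assms(2)
proof (rule kappa_on_nonzeroE)
  fix G assume G: "G \<subseteq> H" "pi_on V a b G \<noteq> 0"
  from pi_on_nonzero_no_dangling[OF assms(1) G(2) assms(3-7)] show ?thesis
    using reach_mono[OF _ G(1) order_refl] by metis
qed

section \<open>Gluing two graphs at a vertex\<close>

text \<open>
  The first graph joins \<open>a\<close> to \<open>v\<close>, the second one joins \<open>v\<close> to \<open>b\<close>; \<open>v\<close> is their only common vertex.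
\<close>
locale gluing =
  fixes A B :: "'a set" and a v b :: 'a and G1 G2 :: "'a set set"
  assumes fin: "finite A" "finite B" and disj: "A \<inter> B = {}"
    and distinct: "a \<noteq> v" "v \<noteq> b" "a \<noteq> b"
    and notin: "a \<notin> A" "a \<notin> B" "v \<notin> A" "v \<notin> B" "b \<notin> A" "b \<notin> B"
    and G1: "G1 \<subseteq> edges_on (A \<union> {a, v})" and G2: "G2 \<subseteq> edges_on (B \<union> {v, b})"
begin

lemma edge_cases:
  assumes "{x, y} \<in> G1 \<union> G2"
  shows "{x, y} \<in> G1 \<and> x \<in> A \<union> {a, v} \<and> y \<in> A \<union> {a, v} \<or>
         {x, y} \<in> G2 \<and> x \<in> B \<union> {v, b} \<and> y \<in> B \<union> {v, b}"
  using assms G1[THEN subsetD, of "{x, y}"] G2[THEN subsetD, of "{x, y}"]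
  unfolding doubleton_edges_on by auto

lemma reach_glue:
  assumes "I1 \<subseteq> A" "I2 \<subseteq> B"
  shows "reach (G1 \<union> G2) (insert v (I1 \<union> I2) \<union> {a, b}) a b \<longleftrightarrow>
    reach G1 (I1 \<union> {a, v}) a v \<and> reach G2 (I2 \<union> {v, b}) v b"
proof
  assume "reach G1 (I1 \<union> {a, v}) a v \<and> reach G2 (I2 \<union> {v, b}) v b"
  then show "reach (G1 \<union> G2) (insert v (I1 \<union> I2) \<union> {a, b}) a b"
    by (intro reach_trans[of _ _ a v b]) (auto elim: reach_mono)
next
  let ?R1 = "reach G1 (I1 \<union> {a, v})" and ?R2 = "reach G2 (I2 \<union> {v, b})"
  assume r: "reach (G1 \<union> G2) (insert v (I1 \<union> I2) \<union> {a, b}) a b"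
  have "z \<in> A \<union> {a, v} \<and> ?R1 a z \<or> z \<in> B \<union> {b} \<and> ?R1 a v \<and> ?R2 v z"
    if "reach (G1 \<union> G2) (insert v (I1 \<union> I2) \<union> {a, b}) a z" for z
    using that
  proof (induction rule: reach_induct)
    case (step x y)
    from edge_cases[OF step(2)] show ?case
    proof
      assume *: "{x, y} \<in> G1 \<and> x \<in> A \<union> {a, v} \<and> y \<in> A \<union> {a, v}"
      then have "x \<in> I1 \<union> {a, v}" "y \<in> I1 \<union> {a, v}"
        using step assms disj notin distinct by auto
      then have "?R1 x y" using * by (simp add: reach_edge)
      moreover have "?R1 a x" using * step.IH disj notin distinct by auto
      ultimately have "?R1 a y" by (rule reach_trans[rotated])
      then show ?thesis using * by simp
    next
      assume *: "{x, y} \<in> G2 \<and> x \<in> B \<union> {v, b} \<and> y \<in> B \<union> {v, b}"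
      then have "x \<in> I2 \<union> {v, b}" "y \<in> I2 \<union> {v, b}"
        using step assms disj notin distinct by auto
      then have "?R2 x y" using * by (simp add: reach_edge)
      moreover have R: "?R1 a v" "?R2 v x" using * step.IH disj notin distinct by auto
      ultimately have "?R2 v y" by (blast intro: reach_trans)
      then show ?thesis using * R by auto
    qed
  qed simp
  from this[OF r] show "?R1 a v \<and> ?R2 v b" using distinct notin by auto
qed

lemma reach_avoiding_subset:
  assumes "reach (G1 \<union> G2) S a u" "v \<notin> S"
  shows "u \<in> A \<union> {a}"
proof -
  have "y \<in> A \<union> {a}" if "x \<in> A \<union> {a}" "{x, y} \<in> G1 \<union> G2" "y \<in> S" for x y
    using edge_cases[OF that(2)] that assms(2) disj notin distinct by auto
  then show ?thesis
    using reach_closed[OF assms(1), of "A \<union> {a}" UNIV] by simp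
qed

lemma not_reach_avoiding: "v \<notin> S \<Longrightarrow> \<not> reach (G1 \<union> G2) S a b"
  using reach_avoiding_subset[of S b] distinct notin by auto

text \<open>
  Only the sets that contain \<open>v\<close> contribute, and for these the connection splits into two
  independent ones. The sign splits too, as \<open>v\<close> is counted on both sides of the exponent.
\<close>
lemma pi_on_glue:
  "pi_on (insert v (A \<union> B)) a b (G1 \<union> G2) = pi_on A a v G1 * pi_on B v b G2"
proof -
  have sgn: "card (insert v (A \<union> B)) - card (insert v (X \<union> Y)) = (card A - card X) + (card B - card Y)"
    if "X \<in> Pow A" "Y \<in> Pow B" for X Y
  proof -
    have *: "X \<subseteq> A" "Y \<subseteq> B" "finite X" "finite Y" "X \<inter> Y = {}" "v \<notin> X \<union> Y"
      using that fin disj notin by (auto intro: finite_subset)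
    have "card (X \<union> Y) = card X + card Y" "card X \<le> card A" "card Y \<le> card B"
      using * fin by (auto intro: card_Un_disjoint card_mono)
    moreover have "card (A \<union> B) = card A + card B" using fin disj by (rule card_Un_disjoint)
    ultimately show ?thesis using * fin notin by simp
  qed
  have "pi_on (insert v (A \<union> B)) a b (G1 \<union> G2) =
    (\<Sum>I\<in>Pow (A \<union> B). (-1) ^ (card (insert v (A \<union> B)) - card (insert v I)) *
        of_bool (reach (G1 \<union> G2) (insert v I \<union> {a, b}) a b))"
  proof -
    have "\<not> reach (G1 \<union> G2) (I \<union> {a, b}) a b" if "I \<in> Pow (A \<union> B)" for I
      by (rule not_reach_avoiding) (use that notin distinct in auto)
    then show ?thesis
      unfolding pi_on_def using fin notin
      by (subst sum_Pow_insert) (auto intro!: sum.cong)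
  qed
  also have "\<dots> = (\<Sum>X\<in>Pow A. \<Sum>Y\<in>Pow B.
      ((-1) ^ (card A - card X) * of_bool (reach G1 (X \<union> {a, v}) a v)) *
      ((-1) ^ (card B - card Y) * of_bool (reach G2 (Y \<union> {v, b}) v b)))"
    unfolding sum_Pow_Un[OF disj]
  proof (intro sum.cong refl)
    fix X Y assume XY: "X \<in> Pow A" "Y \<in> Pow B"
    then have "X \<subseteq> A" "Y \<subseteq> B" by auto
    note glue = reach_glue[OF this]
    show "(-1) ^ (card (insert v (A \<union> B)) - card (insert v (X \<union> Y))) *
        of_bool (reach (G1 \<union> G2) (insert v (X \<union> Y) \<union> {a, b}) a b) =
      ((-1) ^ (card A - card X) * of_bool (reach G1 (X \<union> {a, v}) a v)) *
      ((-1 :: int) ^ (card B - card Y) * of_bool (reach G2 (Y \<union> {v, b}) v b))"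
      unfolding sgn[OF XY] glue power_add of_bool_conj by (simp only: mult_ac)
  qed
  also have "\<dots> = pi_on A a v G1 * pi_on B v b G2"
    by (simp add: pi_on_def sum_product)
  finally show ?thesis .
qed

lemma edges_disjoint: "G1 \<inter> G2 = {}"
proof (intro equals0I)
  fix e assume "e \<in> G1 \<inter> G2"
  then have "e \<in> edges_on (A \<union> {a, v})" "e \<in> edges_on (B \<union> {v, b})" using G1 G2 by auto
  then show False using disj notin distinct by (elim edges_onE) (auto simp: doubleton_eq_iff)
qed

lemma finite_edges: "finite G1" "finite G2"
  using finite_subset[OF G1] finite_subset[OF G2] fin by (auto intro: finite_edges_on)

end

text \<open>
  Subgraphs of glued graphs are glued, so that the factorisation of \<open>\<pi>\<close> carries over to \<open>\<kappa>\<close>.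
\<close>
lemma gluing_subset:
  assumes "gluing A B a v b H1 H2" "G1 \<subseteq> H1" "G2 \<subseteq> H2"
  shows "gluing A B a v b G1 G2"
proof -
  interpret gluing A B a v b H1 H2 by fact
  show ?thesis
    by unfold_locales (use fin disj distinct notin G1 G2 assms(2,3) in auto)
qed

lemma (in gluing) kappa_on_glue:
  "kappa_on (insert v (A \<union> B)) a b (G1 \<union> G2) = kappa_on A a v G1 * kappa_on B v b G2"
proof -
  have "kappa_on (insert v (A \<union> B)) a b (G1 \<union> G2) = (\<Sum>X\<in>Pow G1. \<Sum>Y\<in>Pow G2.
      (pi_on A a v X * (-1) ^ (card G1 - card X)) * (pi_on B v b Y * (-1) ^ (card G2 - card Y)))"
    unfolding kappa_on_def sum_Pow_Un[OF edges_disjoint]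
  proof (intro sum.cong refl)
    fix X Y assume XY: "X \<in> Pow G1" "Y \<in> Pow G2"
    interpret sub: gluing A B a v b X Y
      by (rule gluing_subset[OF gluing_axioms]) (use XY in auto)
    have "card (X \<union> Y) = card X + card Y" "card X \<le> card G1" "card Y \<le> card G2"
      "card (G1 \<union> G2) = card G1 + card G2"
      using XY finite_edges sub.finite_edges edges_disjoint sub.edges_disjoint
      by (auto intro: card_Un_disjoint card_mono)
    then have "card (G1 \<union> G2) - card (X \<union> Y) = (card G1 - card X) + (card G2 - card Y)" by simp
    then show "pi_on (insert v (A \<union> B)) a b (X \<union> Y) * (-1) ^ (card (G1 \<union> G2) - card (X \<union> Y)) =
      (pi_on A a v X * (-1) ^ (card G1 - card X)) * (pi_on B v b Y * (-1) ^ (card G2 - card Y))"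
      by (simp only: sub.pi_on_glue power_add mult_ac)
  qed
  also have "\<dots> = kappa_on A a v G1 * kappa_on B v b G2"
    by (simp add: kappa_on_def sum_product)
  finally show ?thesis .
qed

section \<open>Decomposition at the last pivotal vertex\<close>

text \<open>
  The polynomial in the edge weights \<open>w\<close> with coefficients \<open>\<kappa>\<close>. The flag restricts it to the graphs
  without pivotal vertex: \<open>graph_sum False\<close> belongs to the coefficients \<open>p\<^sub>n\<close> and \<open>graph_sum True\<close>
  to \<open>q\<^sub>n\<close>.
\<close>
definition graph_sum :: "bool \<Rightarrow> 'a set \<Rightarrow> 'a \<Rightarrow> 'a \<Rightarrow> ('a set \<Rightarrow> real) \<Rightarrow> real" where
  "graph_sum np V a b w = (\<Sum>H\<in>{H \<in> Pow (edges_on (V \<union> {a, b})). np \<longrightarrow> no_pivotal V a b H}.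
     of_int (kappa_on V a b H) * (\<Prod>e\<in>H. w e))"

locale nonzero_gluing = gluing A B a v b H1 H2
  for A B :: "'a set" and a v b :: 'a and H1 H2 :: "'a set set" +
  assumes nonzero: "kappa_on A a v H1 \<noteq> 0" "kappa_on B v b H2 \<noteq> 0"
begin

text \<open>
  The side of \<open>a\<close> can be recovered from the glued graph and \<open>v\<close>: since \<open>\<kappa> \<noteq> 0\<close> excludes dangling
  parts at \<open>v\<close>, its vertices are those that \<open>a\<close> reaches without \<open>v\<close>.
\<close>
lemma side_eq: "A = {u \<in> A \<union> B. reach (H1 \<union> H2) (A \<union> B \<union> {a, b}) a u}"
proof -
  have "reach (H1 \<union> H2) (A \<union> B \<union> {a, b}) a u" if "u \<in> A" for u
  proof -
    let ?W = "insert v (A \<union> B) \<union> {a, b} - {v}"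
    have W: "?W = A \<union> B \<union> {a, b}" using notin distinct by auto
    have "reach (H1 \<union> H2) ?W a u \<or> reach (H1 \<union> H2) ?W b u"
      by (rule kappa_on_nonzero_no_dangling)
        (use fin notin distinct nonzero that in \<open>auto simp: kappa_on_glue\<close>)
    moreover have "\<not> reach (H1 \<union> H2) ?W b u"
    proof
      assume "reach (H1 \<union> H2) ?W b u"
      then have "u \<in> B \<union> {b} \<and> reach (H1 \<union> H2) (?W \<inter> (B \<union> {b})) b u"
      proof (rule reach_closed)
        fix x y assume xy: "x \<in> B \<union> {b}" "{x, y} \<in> H1 \<union> H2" "y \<in> ?W"
        show "y \<in> B \<union> {b} \<and> {x, y} \<in> H1 \<union> H2"
          using edge_cases[OF xy(2)] xy disj notin distinct by auto
      qed simp
      then show False using that disj notin by auto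
    qed
    ultimately show ?thesis unfolding W by blast
  qed
  moreover have "u \<in> A" if "u \<in> A \<union> B" "reach (H1 \<union> H2) (A \<union> B \<union> {a, b}) a u" for u
    using reach_avoiding_subset[OF that(2)] that(1) notin distinct by auto
  ultimately show ?thesis by blast
qed

lemma restrict_edges: "H1 = (H1 \<union> H2) \<inter> edges_on (A \<union> {a, v})" "H2 = (H1 \<union> H2) \<inter> edges_on (B \<union> {v, b})"
proof -
  interpret s: gluing A B a v b "edges_on (A \<union> {a, v})" "edges_on (B \<union> {v, b})"
    by unfold_locales (use fin disj distinct notin in auto)
  show "H1 = (H1 \<union> H2) \<inter> edges_on (A \<union> {a, v})" "H2 = (H1 \<union> H2) \<inter> edges_on (B \<union> {v, b})"
    using G1 G2 s.edges_disjoint by blast+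
qed

lemma glue_has_pivotal: "\<not> no_pivotal (insert v (A \<union> B)) a b (H1 \<union> H2)"
  using not_reach_avoiding[of "insert v (A \<union> B) \<union> {a, b} - {v}"] by (auto simp: no_pivotal_def)

text \<open>
  If the second graph has no pivotal vertex, then \<open>v\<close> is the last pivotal vertex of the glued graph: any
  vertex beyond it can be bypassed inside the second graph.
\<close>
lemma pivotal_in_side:
  assumes "no_pivotal B v b H2" "u \<in> insert v (A \<union> B)"
    and "\<not> reach (H1 \<union> H2) (insert v (A \<union> B) \<union> {a, b} - {u}) a b"
  shows "u \<in> insert v A"
proof (rule ccontr)
  assume "u \<notin> insert v A"
  then have u: "u \<in> B" using assms by auto
  then have "reach H2 (B \<union> {v, b} - {u}) v b" using assms by (auto simp: no_pivotal_def)
  then have 2: "reach (H1 \<union> H2) (insert v (A \<union> B) \<union> {a, b} - {u}) v b"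
    by (rule reach_mono) auto
  have "reach H1 (A \<union> {a, v}) a v"
    using kappa_on_nonzero_connected[OF fin(1) nonzero(1)] by simp
  then have "reach (H1 \<union> H2) (insert v (A \<union> B) \<union> {a, b} - {u}) a v"
    by (rule reach_mono) (use u disj notin in auto)
  with 2 assms(3) show False by (blast intro: reach_trans)
qed

end

text \<open>
  If the cut vertices \<open>v\<close> and \<open>v'\<close> differed, each would lie strictly before the other. Then \<open>a\<close>
  reaches \<open>v\<close> without \<open>v'\<close>, and from \<open>v\<close> the second graph leads to \<open>b\<close> without \<open>v'\<close>,
  so that \<open>v'\<close> would not be pivotal.
\<close>
lemma last_pivotal_unique:
  assumes 1: "nonzero_gluing A B a v b H1 H2" "no_pivotal B v b H2"
    and 2: "nonzero_gluing A' B' a v' b H1' H2'" "no_pivotal B' v' b H2'"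
    and V: "insert v (A \<union> B) = insert v' (A' \<union> B')" and H: "H1 \<union> H2 = H1' \<union> H2'"
  shows "v = v' \<and> A = A' \<and> H1 = H1' \<and> H2 = H2'"
proof -
  interpret x: nonzero_gluing A B a v b H1 H2 by fact
  interpret y: nonzero_gluing A' B' a v' b H1' H2' by fact
  let ?W = "insert v (A \<union> B) \<union> {a, b}"
  have piv: "\<not> reach (H1 \<union> H2) (?W - {v}) a b" "\<not> reach (H1 \<union> H2) (?W - {v'}) a b"
    using x.not_reach_avoiding y.not_reach_avoiding H by auto
  have "v = v'"
  proof (rule ccontr)
    assume ne: "v \<noteq> v'"
    have "v' \<in> A" using x.pivotal_in_side[OF 1(2), of v'] piv V ne by auto
    moreover have "v \<in> A'" using y.pivotal_in_side[OF 2(2), of v] piv V H ne by auto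
    ultimately have "reach (H1' \<union> H2') (A' \<union> B' \<union> {a, b}) a v"
      using y.side_eq by blast
    then have "reach (H1 \<union> H2) (?W - {v'}) a v"
      unfolding H by (rule reach_mono) (use V y.notin y.distinct in auto)
    moreover have "reach H2 (B \<union> {v, b}) v b"
      using kappa_on_nonzero_connected[OF x.fin(2) x.nonzero(2)] by simp
    then have "reach (H1 \<union> H2) (?W - {v'}) v b"
      by (rule reach_mono) (use \<open>v' \<in> A\<close> x.disj x.notin in auto)
    ultimately show False using piv(2) by (blast intro: reach_trans)
  qed
  moreover have AB: "A \<union> B = A' \<union> B'"
    using V \<open>v = v'\<close> x.notin y.notin by auto
  then have A: "A = A'"
    using x.side_eq y.side_eq H by simp
  moreover have "B = B'"
    using AB A x.disj y.disj by auto
  ultimately show ?thesis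
    using x.restrict_edges y.restrict_edges H by simp
qed

text \<open>
  The last pivotal vertex is the one whose removal leaves \<open>b\<close> with the fewest reachable
  vertices: a pivotal vertex of the second graph would leave even fewer.
\<close>
lemma last_pivotal_exists:
  assumes V: "finite V" "a \<noteq> b" "a \<notin> V" "b \<notin> V"
    and H: "H \<subseteq> edges_on (V \<union> {a, b})" "kappa_on V a b H \<noteq> 0" "\<not> no_pivotal V a b H"
  obtains A v H1 H2 where "v \<in> V" "A \<subseteq> V - {v}" "H = H1 \<union> H2"
    "nonzero_gluing A (V - {v} - A) a v b H1 H2" "no_pivotal (V - {v} - A) v b H2"
proof -
  define W where "W = V \<union> {a, b}"
  define piv where "piv v \<longleftrightarrow> v \<in> V \<and> \<not> reach H (W - {v}) a b" for v
  define R where "R v = {u. reach H (W - {v}) b u}" for v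
  have finR: "finite (R v)" for v
  proof (rule finite_subset)
    show "R v \<subseteq> insert b W" using reach_in[of H "W - {v}" b] by (auto simp: R_def)
  qed (use V in \<open>auto simp: W_def\<close>)
  obtain v0 where "piv v0" using H(3) by (auto simp: no_pivotal_def piv_def W_def)
  then obtain v where v: "piv v" and least: "\<And>u. piv u \<Longrightarrow> card (R v) \<le> card (R u)"
    using ex_has_least_nat[of piv v0 "\<lambda>v. card (R v)"] by auto
  define A where "A = {u \<in> V - {v}. reach H (W - {v}) a u}"
  define B where "B = V - {v} - A"
  define H1 where "H1 = H \<inter> edges_on (A \<union> {a, v})"
  define H2 where "H2 = H \<inter> edges_on (B \<union> {v, b})"
  have vV: "v \<in> V" and vpiv: "\<not> reach H (W - {v}) a b" using v by (auto simp: piv_def)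
  have VAB: "V = insert v (A \<union> B)" "A \<inter> B = {}" "v \<notin> A" "v \<notin> B"
    using vV by (auto simp: A_def B_def)
  interpret gluing A B a v b H1 H2
    by unfold_locales (use V vV in \<open>auto simp: A_def B_def H1_def H2_def\<close>)
  have HH: "H = H1 \<union> H2"
  proof -
    have "e \<in> H1 \<union> H2" if e: "e \<in> H" for e
    proof -
      obtain x y where xy: "e = {x, y}" "x \<in> W" "y \<in> W" "x \<noteq> y"
        using e H(1) unfolding W_def by (blast elim: edges_onE)
      have no: False
        if "x \<in> A \<union> {a}" "y \<in> B \<union> {b}" "{x, y} \<in> H" "x \<in> W" "y \<in> W" for x y
      proof -
        have "reach H (W - {v}) a x" using that by (auto simp: A_def)
        moreover have "x \<noteq> v" "y \<noteq> v" using that VAB V vV by auto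
        then have "reach H (W - {v}) x y" using that by (intro reach_edge) auto
        ultimately have r: "reach H (W - {v}) a y" by (rule reach_trans)
        then have "y \<noteq> b" using vpiv by auto
        then have "y \<in> A" using r that by (auto simp: A_def B_def)
        then show False using that VAB \<open>y \<noteq> b\<close> by auto
      qed
      have "x \<in> insert v (A \<union> B) \<union> {a, b}" "y \<in> insert v (A \<union> B) \<union> {a, b}"
        using xy VAB by (auto simp: W_def)
      then have "x \<in> A \<union> {a, v} \<and> y \<in> A \<union> {a, v} \<or> x \<in> B \<union> {v, b} \<and> y \<in> B \<union> {v, b}"
        using no[of x y] no[of y x] xy e by (auto simp: insert_commute)
      then show ?thesis
        using e xy by (auto simp: H1_def H2_def doubleton_edges_on)
    qed
    then show ?thesis by (auto simp: H1_def H2_def)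
  qed
  have "kappa_on A a v H1 * kappa_on B v b H2 \<noteq> 0"
    using H(2) kappa_on_glue VAB(1) HH by simp
  then have nz: "nonzero_gluing A B a v b H1 H2" by unfold_locales auto
  have "no_pivotal B v b H2"
  proof (rule ccontr)
    assume "\<not> no_pivotal B v b H2"
    then obtain u where u: "u \<in> B" "\<not> reach H2 (B \<union> {v, b} - {u}) v b"
      by (auto simp: no_pivotal_def)
    have uV: "u \<in> V" "u \<noteq> v" "u \<noteq> b" using u V by (auto simp: B_def)
    \<comment> \<open>A walk from \<open>a\<close> to \<open>b\<close> that avoids \<open>u\<close> would pass \<open>v\<close> and then avoid \<open>u\<close> in the second graph.\<close>
    have "piv u"
    proof -
      have W: "W - {u} = insert v (A \<union> (B - {u})) \<union> {a, b}" "(B - {u}) \<union> {v, b} = B \<union> {v, b} - {u}"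
        using u(1) VAB V by (auto simp: W_def)
      have "\<not> reach H (W - {u}) a b"
        using reach_glue[of A "B - {u}"] u(2) unfolding W HH by auto
      then show ?thesis using uV by (simp add: piv_def)
    qed
    \<comment> \<open>Without \<open>u\<close>, a walk from \<open>b\<close> cannot even reach \<open>v\<close>, so it avoids \<open>v\<close> too.\<close>
    have "R u \<subseteq> R v"
    proof
      fix y assume "y \<in> R u"
      then have r: "reach H (W - {u}) b y" by (simp add: R_def)
      let ?C = "{z \<in> B \<union> {b} - {u}. reach H2 (B \<union> {v, b} - {u}) b z}"
      have "y \<in> ?C \<and> reach H ((W - {u}) \<inter> ?C) b y"
      proof (rule reach_closed[OF r])
        show "b \<in> ?C" using uV by simp
      next
        fix x z assume x: "x \<in> ?C" and xz: "{x, z} \<in> H" "x \<in> W - {u}" "z \<in> W - {u}"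
        from xz(1) have "{x, z} \<in> H1 \<union> H2" by (simp add: HH)
        then have z: "{x, z} \<in> H2" "z \<in> B \<union> {v, b}"
          using edge_cases[of x z] x disj notin distinct by auto
        have "reach H2 (B \<union> {v, b} - {u}) x z"
          using z x xz by (intro reach_edge) auto
        then have bz: "reach H2 (B \<union> {v, b} - {u}) b z" using x by (blast intro: reach_trans)
        then have "z \<noteq> v" using u(2) by (auto dest: reach_sym)
        then show "z \<in> ?C \<and> {x, z} \<in> H" using z xz bz by auto
      qed
      then have "reach H ((W - {u}) \<inter> ?C) b y" by simp
      then have "reach H (W - {v}) b y" by (rule reach_mono) (use notin distinct in auto)
      then show "y \<in> R v" by (simp add: R_def)
    qed
    moreover have "u \<in> R v"
      using kappa_on_nonzero_no_dangling[OF V(1) H(2) vV uV(1,2) V(3,4)] u(1) uV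
      by (auto simp: R_def A_def B_def W_def)
    moreover have "u \<notin> R u"
      using reach_in[of H "W - {u}" b u] uV by (auto simp: R_def)
    ultimately have "card (R u) < card (R v)" by (intro psubset_card_mono finR) blast
    then show False using least[OF \<open>piv u\<close>] by simp
  qed
  then show ?thesis
    using that[of v A H1 H2] vV HH nz by (auto simp: B_def A_def)
qed

text \<open>
  By uniqueness and existence of the last pivotal vertex, gluing is a bijection from the
  pairs of graphs with nonzero \<open>\<kappa>\<close>, the second one without pivotal vertex, onto the graphs with
  nonzero \<open>\<kappa>\<close> that have a pivotal vertex. The coefficients and the weights are multiplicative.
  Terms with \<open>\<kappa> = 0\<close> have to be discarded on both sides first: a part that hangs on \<open>v\<close> alone
  could be put on either side, so that gluing is not injective on them.
\<close>
theorem graph_sum_decompose: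
  assumes V: "finite V" "a \<noteq> b" "a \<notin> V" "b \<notin> V"
  shows "graph_sum False V a b w =
    graph_sum True V a b w + (\<Sum>v\<in>V. \<Sum>A\<in>Pow (V - {v}). graph_sum False A a v w * graph_sum True (V - {v} - A) v b w)"
proof -
  let ?W = "V \<union> {a, b}"
  define f where "f V a b H = real_of_int (kappa_on V a b H) * (\<Prod>e\<in>H. w e)" for V a b H
  define E where "E = {H \<in> Pow (edges_on ?W). \<not> no_pivotal V a b H}"
  define D where "D v A = Pow (edges_on (A \<union> {a, v})) \<times>
     {H \<in> Pow (edges_on ((V - {v} - A) \<union> {v, b})). no_pivotal (V - {v} - A) v b H}" for v A
  define T where "T = (SIGMA v:V. SIGMA A:Pow (V - {v}). D v A)"
  define g where "g = (\<lambda>(v, A, H1, H2). f A a v H1 * f (V - {v} - A) v b H2)"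
  define h where "h = (\<lambda>(v :: 'a, A :: 'a set, H1 :: 'a set set, H2). H1 \<union> H2)"
  have finite_D: "finite (D v A)" if "A \<in> Pow (V - {v})" for v A
  proof -
    have "finite (edges_on (A \<union> {a, v}))" "finite (edges_on ((V - {v} - A) \<union> {v, b}))"
      using that V(1) finite_subset[of A V] by (auto intro!: finite_edges_on)
    then show ?thesis by (simp add: D_def)
  qed
  have glue: "gluing A (V - {v} - A) a v b H1 H2" if "(v, A, H1, H2) \<in> T" for v A H1 H2
    using that V by unfold_locales (auto simp: T_def D_def intro: finite_subset)
  have part: "V = insert v (A \<union> (V - {v} - A))" if "v \<in> V" "A \<subseteq> V - {v}" for v A
    using that by auto
  have g_h: "g x = f V a b (h x)" if x: "x \<in> T" for x
  proof -
    obtain v A H1 H2 where [simp]: "x = (v, A, H1, H2)" by (cases x) auto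
    interpret gluing A "V - {v} - A" a v b H1 H2 using glue x by simp
    have p: "insert v (A \<union> (V - {v} - A)) = V" using part x by (auto simp: T_def)
    have "kappa_on V a b (H1 \<union> H2) = kappa_on A a v H1 * kappa_on (V - {v} - A) v b H2"
      using kappa_on_glue unfolding p .
    then show ?thesis
      using finite_edges edges_disjoint by (simp add: g_def h_def f_def prod.union_disjoint)
  qed
  have nz: "nonzero_gluing A (V - {v} - A) a v b H1 H2 \<and> no_pivotal (V - {v} - A) v b H2"
    if x: "(v, A, H1, H2) \<in> T" "g (v, A, H1, H2) \<noteq> 0" for v A H1 H2
  proof -
    interpret gluing A "V - {v} - A" a v b H1 H2 using glue x by simp
    show ?thesis using x
      by (auto simp: T_def D_def g_def f_def nonzero_gluing_def nonzero_gluing_axioms_def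
          intro: gluing_axioms)
  qed
  have bij: "bij_betw h {x \<in> T. g x \<noteq> 0} {H \<in> E. f V a b H \<noteq> 0}"
  proof (intro bij_betwI')
    fix x y assume x: "x \<in> {x \<in> T. g x \<noteq> 0}" and y: "y \<in> {x \<in> T. g x \<noteq> 0}"
    obtain v A H1 H2 where [simp]: "x = (v, A, H1, H2)" by (cases x) auto
    obtain v' A' H1' H2' where [simp]: "y = (v', A', H1', H2')" by (cases y) auto
    have p: "insert v (A \<union> (V - {v} - A)) = insert v' (A' \<union> (V - {v'} - A'))"
      using x y by (auto simp: T_def)
    have nx: "nonzero_gluing A (V - {v} - A) a v b H1 H2" "no_pivotal (V - {v} - A) v b H2"
      and ny: "nonzero_gluing A' (V - {v'} - A') a v' b H1' H2'" "no_pivotal (V - {v'} - A') v' b H2'"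
      using nz x y by auto
    show "h x = h y \<longleftrightarrow> x = y"
      using last_pivotal_unique[OF nx ny p] by (auto simp: h_def)
  next
    fix x assume x: "x \<in> {x \<in> T. g x \<noteq> 0}"
    obtain v A H1 H2 where [simp]: "x = (v, A, H1, H2)" by (cases x) auto
    interpret nonzero_gluing A "V - {v} - A" a v b H1 H2 using nz x by simp
    have p: "insert v (A \<union> (V - {v} - A)) = V" "v \<in> V" "A \<subseteq> V" using part x by (auto simp: T_def)
    have "\<not> no_pivotal V a b (H1 \<union> H2)" using glue_has_pivotal unfolding p .
    moreover have "H1 \<union> H2 \<subseteq> edges_on ?W"
      using G1 G2 edges_on_mono[of "A \<union> {a, v}" ?W] edges_on_mono[of "(V - {v} - A) \<union> {v, b}" ?W] p by auto
    ultimately show "h x \<in> {H \<in> E. f V a b H \<noteq> 0}"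
      using x g_h[of x] by (auto simp: E_def h_def)
  next
    fix H assume H: "H \<in> {H \<in> E. f V a b H \<noteq> 0}"
    then have "H \<subseteq> edges_on ?W" "kappa_on V a b H \<noteq> 0" "\<not> no_pivotal V a b H" by (auto simp: E_def f_def)
    then obtain A v H1 H2 where *: "v \<in> V" "A \<subseteq> V - {v}" "H = H1 \<union> H2"
      "nonzero_gluing A (V - {v} - A) a v b H1 H2" "no_pivotal (V - {v} - A) v b H2"
      using last_pivotal_exists[OF V] by metis
    interpret nonzero_gluing A "V - {v} - A" a v b H1 H2 by fact
    have "(v, A, H1, H2) \<in> T" using * G1 G2 by (auto simp: T_def D_def)
    moreover have "h (v, A, H1, H2) = H" using * by (simp add: h_def)
    ultimately show "\<exists>x\<in>{x \<in> T. g x \<noteq> 0}. H = h x"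
      using H g_h[of "(v, A, H1, H2)"] by (intro bexI[of _ "(v, A, H1, H2)"]) auto
  qed
  have finite_T: "finite T"
    unfolding T_def using V(1) finite_D by (intro finite_SigmaI) auto
  have finite_E: "finite E"
    unfolding E_def using V(1) by (auto intro!: finite_edges_on)
  have "(\<Sum>v\<in>V. \<Sum>A\<in>Pow (V - {v}). graph_sum False A a v w * graph_sum True (V - {v} - A) v b w) =
    (\<Sum>v\<in>V. \<Sum>A\<in>Pow (V - {v}). \<Sum>(H1, H2)\<in>D v A. g (v, A, H1, H2))"
    unfolding graph_sum_def D_def sum_product f_def g_def
    by (simp add: sum.cartesian_product Pow_def)
  also have "\<dots> = (\<Sum>v\<in>V. \<Sum>y\<in>(SIGMA A:Pow (V - {v}). D v A). g (v, y))"
    using V(1) finite_D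
    by (intro sum.cong refl, subst sum.Sigma) (auto simp: split_def intro!: sum.cong)
  also have "\<dots> = (\<Sum>x\<in>T. g x)"
    unfolding T_def using V(1) finite_D
    by (subst sum.Sigma) (auto simp: split_def intro!: finite_SigmaI)
  also have "\<dots> = (\<Sum>x\<in>{x \<in> T. g x \<noteq> 0}. g x)"
    by (rule sum.mono_neutral_right[OF finite_T]) auto
  also have "\<dots> = (\<Sum>x\<in>{x \<in> T. g x \<noteq> 0}. f V a b (h x))"
    by (rule sum.cong) (auto simp: g_h)
  also have "\<dots> = (\<Sum>H\<in>{H \<in> E. f V a b H \<noteq> 0}. f V a b H)"
    by (rule sum.reindex_bij_betw[OF bij])
  also have "\<dots> = (\<Sum>H\<in>E. f V a b H)"
    by (rule sum.mono_neutral_left[OF finite_E]) auto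
  finally have rest: "(\<Sum>v\<in>V. \<Sum>A\<in>Pow (V - {v}). graph_sum False A a v w * graph_sum True (V - {v} - A) v b w) =
    (\<Sum>H\<in>E. f V a b H)" .
  have "graph_sum False V a b w = (\<Sum>H\<in>{H \<in> Pow (edges_on ?W). no_pivotal V a b H} \<union> E. f V a b H)"
    unfolding graph_sum_def f_def by (rule sum.cong) (auto simp: E_def)
  also have "\<dots> = graph_sum True V a b w + (\<Sum>H\<in>E. f V a b H)"
    using V(1) finite_E
    by (subst sum.union_disjoint) (auto simp: graph_sum_def f_def E_def intro!: finite_edges_on)
  finally show ?thesis using rest by simp
qed

section \<open>Relabelling the vertices\<close>
lemma graph_sum_cong:
  assumes "\<And>e. e \<in> edges_on (V \<union> {a, b}) \<Longrightarrow> w e = w' e"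
  shows "graph_sum np V a b w = graph_sum np V a b w'"
  unfolding graph_sum_def using assms by (intro sum.cong refl arg_cong2[where f = "(*)"] prod.cong) auto

lemma image_edge_in_edges_on:
  assumes "inj_on f W" "e \<in> edges_on W"
  shows "f ` e \<in> edges_on (f ` W)"
  using assms inj_on_subset[of f W e] by (auto simp: edges_on_def card_image)

lemma reach_relabel:
  assumes inj: "inj_on f W" and G: "G \<subseteq> edges_on W" and S: "S \<subseteq> W" "u \<in> S" "v \<in> S"
  shows "reach ((`) f ` G) (f ` S) (f u) (f v) \<longleftrightarrow> reach G S u v"
proof -
  have "{e \<in> (`) f ` G. e \<subseteq> f ` S} = (`) f ` {e \<in> G. e \<subseteq> S}"
  proof -
    have "f ` e \<subseteq> f ` S \<longleftrightarrow> e \<subseteq> S" if "e \<in> G" for e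
      using that G S by (intro inj_on_image_subset_iff[OF inj]) (auto simp: edges_on_def)
    then show ?thesis by auto
  qed
  then have "reach ((`) f ` G) (f ` S) (f u) (f v) \<longleftrightarrow>
      reach ((`) f ` {e \<in> G. e \<subseteq> S}) (f ` S) (f u) (f v)"
    using reach_restrict_edges[of "(`) f ` G" "f ` S"] by simp
  also have "\<dots> \<longleftrightarrow> reach {e \<in> G. e \<subseteq> S} S u v"
    by (rule reach_image) (use inj_on_subset[OF inj] S in auto)
  also have "\<dots> \<longleftrightarrow> reach G S u v" by (rule reach_restrict_edges)
  finally show ?thesis .
qed

context
  fixes f :: "'a \<Rightarrow> 'b" and V :: "'a set" and a b :: 'a
  assumes inj: "inj_on f (V \<union> {a, b})"
begin

lemma inj_image: "inj_on ((`) f) (edges_on (V \<union> {a, b}))"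
  using inj_on_image_Pow[OF inj] by (rule inj_on_subset) (auto simp: edges_on_def)

lemma pi_on_relabel:
  assumes "G \<subseteq> edges_on (V \<union> {a, b})"
  shows "pi_on (f ` V) (f a) (f b) ((`) f ` G) = pi_on V a b G"
proof -
  have injV: "inj_on f V" using inj by (rule inj_on_subset) auto
  have "pi_on (f ` V) (f a) (f b) ((`) f ` G) =
    (\<Sum>I\<in>Pow V. (-1) ^ (card (f ` V) - card (f ` I)) *
       of_bool (reach ((`) f ` G) (f ` I \<union> {f a, f b}) (f a) (f b)))"
    unfolding pi_on_def image_Pow_surj[OF refl, symmetric]
    by (subst sum.reindex[OF inj_on_image_Pow[OF injV]]) simp
  also have "\<dots> = pi_on V a b G"
    unfolding pi_on_def
  proof (intro sum.cong refl)
    fix I assume I: "I \<in> Pow V"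
    have "card (f ` V) = card V" "card (f ` I) = card I"
      using I injV by (auto intro!: card_image intro: inj_on_subset)
    moreover have "reach ((`) f ` G) (f ` (I \<union> {a, b})) (f a) (f b) \<longleftrightarrow> reach G (I \<union> {a, b}) a b"
      by (rule reach_relabel[OF inj assms]) (use I in auto)
    ultimately show "(-1) ^ (card (f ` V) - card (f ` I)) *
       of_bool (reach ((`) f ` G) (f ` I \<union> {f a, f b}) (f a) (f b)) =
       (-1 :: int) ^ (card V - card I) * of_bool (reach G (I \<union> {a, b}) a b)"
      by simp
  qed
  finally show ?thesis .
qed

lemma kappa_on_relabel:
  assumes H: "H \<subseteq> edges_on (V \<union> {a, b})"
  shows "kappa_on (f ` V) (f a) (f b) ((`) f ` H) = kappa_on V a b H"
proof -
  have injH: "inj_on ((`) f) H" using inj_image H by (rule inj_on_subset)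
  have "kappa_on (f ` V) (f a) (f b) ((`) f ` H) =
    (\<Sum>G\<in>Pow H. pi_on (f ` V) (f a) (f b) ((`) f ` G) * (-1) ^ (card ((`) f ` H) - card ((`) f ` G)))"
    unfolding kappa_on_def image_Pow_surj[OF refl, symmetric]
    by (subst sum.reindex[OF inj_on_image_Pow[OF injH]]) simp
  also have "\<dots> = kappa_on V a b H"
    unfolding kappa_on_def
  proof (intro sum.cong refl)
    fix G assume G: "G \<in> Pow H"
    have "card ((`) f ` H) = card H" "card ((`) f ` G) = card G"
      using G injH by (auto intro!: card_image intro: inj_on_subset)
    then show "pi_on (f ` V) (f a) (f b) ((`) f ` G) * (-1) ^ (card ((`) f ` H) - card ((`) f ` G)) =
       pi_on V a b G * (-1) ^ (card H - card G)"
      using pi_on_relabel[of G] G H by auto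
  qed
  finally show ?thesis .
qed

lemma no_pivotal_relabel:
  assumes "H \<subseteq> edges_on (V \<union> {a, b})" "a \<notin> V" "b \<notin> V"
  shows "no_pivotal (f ` V) (f a) (f b) ((`) f ` H) \<longleftrightarrow> no_pivotal V a b H"
proof -
  have "reach ((`) f ` H) (f ` V \<union> {f a, f b} - {f v}) (f a) (f b) \<longleftrightarrow>
      reach H (V \<union> {a, b} - {v}) a b" if "v \<in> V" for v
  proof -
    have "f ` V \<union> {f a, f b} - {f v} = f ` (V \<union> {a, b} - {v})"
      using inj_on_image_set_diff[OF inj, of "V \<union> {a, b}" "{v}"] that by auto
    moreover have "reach ((`) f ` H) (f ` (V \<union> {a, b} - {v})) (f a) (f b) \<longleftrightarrow>
      reach H (V \<union> {a, b} - {v}) a b"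
      by (rule reach_relabel[OF inj assms(1)]) (use that assms in auto)
    ultimately show ?thesis by simp
  qed
  then show ?thesis by (auto simp: no_pivotal_def)
qed

lemma edges_on_image: "edges_on (f ` (V \<union> {a, b})) = (`) f ` edges_on (V \<union> {a, b})"
proof
  show "edges_on (f ` (V \<union> {a, b})) \<subseteq> (`) f ` edges_on (V \<union> {a, b})"
  proof
    fix e assume "e \<in> edges_on (f ` (V \<union> {a, b}))"
    then obtain x y where "e = {f x, f y}" "x \<in> V \<union> {a, b}" "y \<in> V \<union> {a, b}" "f x \<noteq> f y"
      by (elim edges_onE) blast
    then show "e \<in> (`) f ` edges_on (V \<union> {a, b})"
      by (intro image_eqI[of _ _ "{x, y}"]) (auto simp: doubleton_edges_on)
  qed
qed (use image_edge_in_edges_on[OF inj] in blast)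

text \<open>
  This reduces arbitrary vertex sets to \<open>{1..n}\<close> with end points \<open>0\<close> and \<open>n + 1\<close>.
\<close>
lemma graph_sum_relabel:
  assumes "a \<notin> V" "b \<notin> V"
  shows "graph_sum np (f ` V) (f a) (f b) w = graph_sum np V a b (\<lambda>e. w (f ` e))"
proof -
  let ?E = "edges_on (V \<union> {a, b})"
  have W: "f ` V \<union> {f a, f b} = f ` (V \<union> {a, b})" by auto
  have P: "Pow (edges_on (f ` V \<union> {f a, f b})) = (`) ((`) f) ` Pow ?E"
    unfolding W edges_on_image by (simp add: image_Pow_surj)
  have S: "{H \<in> Pow (edges_on (f ` V \<union> {f a, f b})). np \<longrightarrow> no_pivotal (f ` V) (f a) (f b) H} =
    (`) ((`) f) ` {H \<in> Pow ?E. np \<longrightarrow> no_pivotal V a b H}"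
    unfolding P using no_pivotal_relabel assms by auto
  have "inj_on ((`) ((`) f)) {H \<in> Pow ?E. np \<longrightarrow> no_pivotal V a b H}"
    using inj_on_image_Pow[OF inj_image] by (rule inj_on_subset) auto
  then show ?thesis
    unfolding graph_sum_def S
  proof (subst sum.reindex, simp, intro sum.cong refl)
    fix H assume "H \<in> {H \<in> Pow ?E. np \<longrightarrow> no_pivotal V a b H}"
    then have "H \<subseteq> ?E" by simp
    then show "((\<lambda>H. of_int (kappa_on (f ` V) (f a) (f b) H) * prod w H) \<circ> (`) ((`) f)) H =
      of_int (kappa_on V a b H) * (\<Prod>e\<in>H. w (f ` e))"
      using kappa_on_relabel[of H] prod.reindex[OF inj_on_subset[OF inj_image], of H w] by simp
  qed
qed

end

section \<open>Integrals of products of edge weights\<close>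

text \<open>
  An edge is an unordered pair, so one of its two orientations has to be chosen; the
  symmetry of \<open>\<phi>\<close> makes the choice immaterial.
\<close>
definition edge_weight :: "('a::euclidean_space \<Rightarrow> real) \<Rightarrow> (nat \<Rightarrow> 'a) \<Rightarrow> nat set \<Rightarrow> real" where
  "edge_weight \<phi> z e = \<phi> (z (Min e) - z (Max e))"

text \<open>
  The inner vertices \<open>V\<close> are the variables of integration, all other vertices sit at the fixed
  positions \<open>\<rho>\<close>.
\<close>
definition placed :: "nat set \<Rightarrow> (nat \<Rightarrow> 'a) \<Rightarrow> (nat \<Rightarrow> 'a) \<Rightarrow> nat \<Rightarrow> 'a" where
  "placed V \<rho> z = (\<lambda>i. if i \<in> V then z i else \<rho> i)"

abbreviation Leb :: "nat set \<Rightarrow> (nat \<Rightarrow> 'a::euclidean_space) measure" where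
  "Leb V \<equiv> \<Pi>\<^sub>M i\<in>V. lborel"

definition graph_integral :: "('a::euclidean_space \<Rightarrow> real) \<Rightarrow> bool \<Rightarrow> nat set \<Rightarrow> nat \<Rightarrow> nat \<Rightarrow> (nat \<Rightarrow> 'a) \<Rightarrow> real" where
  "graph_integral \<phi> np V a b \<rho> = (\<integral>z. graph_sum np V a b (edge_weight \<phi> (placed V \<rho> z)) \<partial>Leb V)"

text \<open>
  Forests rooted in \<open>R\<close>, with the order in which the vertices \<open>V\<close> are attached. Integrating in the
  reverse order, each variable occurs in a single remaining edge.
\<close>
inductive grown_tree :: "'b set \<Rightarrow> 'b set set \<Rightarrow> 'b set \<Rightarrow> bool" for R where
  grown_empty: "grown_tree R {} {}"
| grown_insert: "grown_tree R T V \<Longrightarrow> u \<notin> V \<union> R \<Longrightarrow> r \<in> V \<union> R \<Longrightarrow> grown_tree R (insert {u, r} T) (insert u V)"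

lemma grown_tree_finite: "grown_tree R T V \<Longrightarrow> finite V \<and> finite T \<and> T \<subseteq> edges_on (V \<union> R)"
proof (induction rule: grown_tree.induct)
  case (grown_insert T V u r)
  then have "{u, r} \<in> edges_on (insert u V \<union> R)" by (auto simp: doubleton_edges_on)
  moreover have "edges_on (V \<union> R) \<subseteq> edges_on (insert u V \<union> R)" by (rule edges_on_mono) auto
  ultimately show ?case using grown_insert by auto
qed simp

text \<open>
  As long as the forest misses a vertex, the walk to this vertex from \<open>R\<close> contains an edge that
  leaves the forest, by which it can be enlarged.
\<close>
lemma connected_grown_tree:
  assumes V: "finite V" and H: "H \<subseteq> edges_on (V \<union> R)"
    and disj: "V \<inter> R = {}"
    and conn: "\<And>u. u \<in> V \<Longrightarrow> \<exists>r\<in>R. reach H S r u"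
  obtains T where "T \<subseteq> H" "grown_tree R T V"
proof -
  have "\<exists>U\<subseteq>V. card U = k \<and> (\<exists>T\<subseteq>H. grown_tree R T U)" if "k \<le> card V" for k
    using that
  proof (induction k)
    case 0
    show ?case by (intro exI[of _ "{}"]) (auto intro: grown_empty)
  next
    case (Suc k)
    then obtain U T where U: "U \<subseteq> V" "card U = k" "T \<subseteq> H" "grown_tree R T U" by auto
    have "U \<noteq> V" using U Suc.prems by auto
    then obtain u where u: "u \<in> V" "u \<notin> U" using U by auto
    obtain r where r: "r \<in> R" "reach H S r u" using conn[OF u(1)] by blast
    have "\<exists>x y. x \<in> U \<union> R \<and> y \<notin> U \<union> R \<and> {x, y} \<in> H"
    proof (rule ccontr)
      assume *: "\<not> ?thesis"
      have "u \<in> U \<union> R \<and> reach H (S \<inter> (U \<union> R)) r u"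
        by (rule reach_closed[OF r(2)]) (use r(1) * in auto)
      then show False using u disj by auto
    qed
    then obtain x y where xy: "x \<in> U \<union> R" "y \<notin> U \<union> R" "{y, x} \<in> H"
      by (metis insert_commute)
    have y: "y \<in> V" using xy H by (auto simp: doubleton_edges_on dest!: subsetD)
    have "grown_tree R (insert {y, x} T) (insert y U)"
      by (rule grown_insert) (use U xy in auto)
    moreover have "card (insert y U) = Suc k"
      using U xy finite_subset[OF U(1) V] by auto
    moreover have "insert {y, x} T \<subseteq> H" "insert y U \<subseteq> V" using U xy y by auto
    ultimately show ?case by blast
  qed
  from this[of "card V"] obtain U T where "U \<subseteq> V" "card U = card V" "T \<subseteq> H" "grown_tree R T U" by auto
  then show ?thesis using that card_subset_eq[OF V] by blast
qed

text \<open>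
  Lebesgue measure on a product depends neither on the names of the coordinates nor on the origin.
\<close>
lemma distr_relabel_translate:
  fixes c :: "'a::euclidean_space"
  assumes I: "finite I" and g: "inj_on g I"
  shows "distr (Leb (g ` I)) (Leb I) (\<lambda>z. \<lambda>i\<in>I. z (g i) - c) = Leb I"
proof -
  interpret product_sigma_finite "\<lambda>_::nat. lborel :: 'a measure" by standard
  let ?T = "\<lambda>z. \<lambda>i\<in>I. z (g i) - c"
  have T: "?T \<in> Leb (g ` I) \<rightarrow>\<^sub>M Leb I"
    by (intro measurable_restrict borel_measurable_diff measurable_component_singleton measurable_const)
       (auto intro: measurable_component_singleton)
  show ?thesis
  proof (rule PiM_eqI[OF I])
    fix A assume A: "\<And>i. i \<in> I \<Longrightarrow> A i \<in> sets (lborel :: 'a measure)"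
    have inv: "inv_into I g (g i) = i" if "i \<in> I" for i
      using that g by simp
    have tr: "emeasure lborel ((\<lambda>y. y - c) -` B) = emeasure lborel B" if "B \<in> sets borel" for B
    proof -
      have "emeasure lborel B = emeasure (distr lborel borel ((+) (- c))) B"
        by (simp add: lborel_distr_plus)
      also have "\<dots> = emeasure lborel ((\<lambda>y. y - c) -` B)"
        using that by (subst emeasure_distr) (auto intro!: arg_cong[where f = "emeasure lborel"])
      finally show ?thesis by simp
    qed
    have "?T -` Pi\<^sub>E I A \<inter> space (Leb (g ` I)) =
      (\<Pi>\<^sub>E j\<in>g ` I. (\<lambda>y. y - c) -` A (inv_into I g j))"
      by (auto simp: space_PiM PiE_iff inv)
    then have "emeasure (distr (Leb (g ` I)) (Leb I) ?T) (Pi\<^sub>E I A) =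
      emeasure (Leb (g ` I)) (\<Pi>\<^sub>E j\<in>g ` I. (\<lambda>y. y - c) -` A (inv_into I g j))"
      using I A by (subst emeasure_distr[OF T]) (auto intro!: sets_PiM_I_finite)
    also have "\<dots> = (\<Prod>j\<in>g ` I. emeasure lborel ((\<lambda>y. y - c) -` A (inv_into I g j)))"
    proof (rule emeasure_PiM)
      fix j assume "j \<in> g ` I"
      then have "A (inv_into I g j) \<in> sets borel" using A inv by auto
      moreover have "(\<lambda>y. y - c) \<in> borel \<rightarrow>\<^sub>M borel" by measurable
      ultimately show "(\<lambda>y. y - c) -` A (inv_into I g j) \<in> sets lborel"
        using measurable_sets[of "\<lambda>y. y - c" borel borel] by simp
    qed (use I in simp)
    also have "\<dots> = (\<Prod>i\<in>I. emeasure lborel (A i))"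
      using A by (subst prod.reindex[OF g]) (auto simp: inv tr intro!: prod.cong)
    finally show "emeasure (distr (Leb (g ` I)) (Leb I) ?T) (Pi\<^sub>E I A) = (\<Prod>i\<in>I. emeasure lborel (A i))" .
  qed simp
qed

locale connection_function =
  fixes \<phi> :: "'a::euclidean_space \<Rightarrow> real"
  assumes \<phi>_measurable [measurable]: "\<phi> \<in> borel_measurable borel"
    and \<phi>_nonneg: "0 \<le> \<phi> y" and \<phi>_le_1: "\<phi> y \<le> 1"
    and \<phi>_sym: "\<phi> (- y) = \<phi> y"
    and \<phi>_integrable: "integrable lborel \<phi>"
begin

sublocale lebesgue_product: product_sigma_finite "\<lambda>_::nat. lborel :: 'a measure"
  by standard

lemma edge_weight_pair: "edge_weight \<phi> z {i, j} = \<phi> (z i - z j)"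
  using \<phi>_sym[of "z i - z j"] by (cases "i \<le> j") (auto simp: edge_weight_def min_def max_def)

lemma edge_weight_cong:
  assumes "e \<in> edges_on W" "\<And>i. i \<in> W \<Longrightarrow> z i = z' i"
  shows "edge_weight \<phi> z e = edge_weight \<phi> z' e"
  using assms by (elim edges_onE) (auto simp: edge_weight_pair)

lemma edge_weight_bounds: "0 \<le> edge_weight \<phi> z e" "edge_weight \<phi> z e \<le> 1"
  by (auto simp: edge_weight_def \<phi>_nonneg \<phi>_le_1)

lemma measurable_edge_weight:
  assumes "\<And>i. (\<lambda>x. z x i) \<in> borel_measurable M"
  shows "(\<lambda>x. edge_weight \<phi> (z x) e) \<in> borel_measurable M"
  unfolding edge_weight_def using assms by measurable

lemma measurable_placed: "(\<lambda>z. placed V \<rho> z i) \<in> borel_measurable (Leb V)"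
  by (cases "i \<in> V") (auto simp: placed_def)

lemma measurable_graph_sum:
  assumes "\<And>i. (\<lambda>x. z x i) \<in> borel_measurable M"
  shows "(\<lambda>x. graph_sum np V a b (edge_weight \<phi> (z x))) \<in> borel_measurable M"
  unfolding graph_sum_def
  by (intro borel_measurable_sum borel_measurable_times borel_measurable_const
      borel_measurable_prod measurable_edge_weight assms)

text \<open>
  The last attached vertex is a leaf, and by translation invariance its integral is
  \<open>\<integral> \<phi>\<close> wherever its neighbour lies.
\<close>
lemma nn_integral_tree:
  assumes "grown_tree R T V"
  shows "(\<integral>\<^sup>+z. ennreal (\<Prod>e\<in>T. edge_weight \<phi> (placed V \<rho> z) e) \<partial>Leb V) =
    (\<integral>\<^sup>+y. ennreal (\<phi> y) \<partial>lborel) ^ card V"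
  using assms
proof (induction rule: grown_tree.induct)
  case grown_empty
  then show ?case by (simp add: lebesgue_product.nn_integral_empty PiM_empty)
next
  case (grown_insert T V u r)
  have fin: "finite V" "finite T" and T: "T \<subseteq> edges_on (V \<union> R)"
    using grown_tree_finite[OF grown_insert(1)] by auto
  have u: "u \<notin> V" using grown_insert by auto
  have notin: "{u, r} \<notin> T" using T grown_insert(2) by (auto simp: doubleton_edges_on dest!: subsetD)
  let ?m = "\<integral>\<^sup>+y. ennreal (\<phi> y) \<partial>lborel"
  have tr: "(\<integral>\<^sup>+y. ennreal (\<phi> (y - c)) \<partial>lborel) = ?m" for c
  proof -
    have "?m = (\<integral>\<^sup>+y. ennreal (\<phi> y) \<partial>(distr lborel borel ((+) (- c))))"
      by (simp add: lborel_distr_plus)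
    also have "\<dots> = (\<integral>\<^sup>+y. ennreal (\<phi> (y - c)) \<partial>lborel)"
      by (subst nn_integral_distr) auto
    finally show ?thesis by simp
  qed
  have "(\<integral>\<^sup>+z. ennreal (\<Prod>e\<in>insert {u, r} T. edge_weight \<phi> (placed (insert u V) \<rho> z) e) \<partial>Leb (insert u V)) =
    (\<integral>\<^sup>+z. \<integral>\<^sup>+y. ennreal (\<Prod>e\<in>insert {u, r} T. edge_weight \<phi> (placed (insert u V) \<rho> (z(u := y))) e) \<partial>lborel \<partial>Leb V)"
    using fin u
    by (intro lebesgue_product.product_nn_integral_insert measurable_compose[OF _ measurable_ennreal]
        borel_measurable_prod measurable_edge_weight measurable_placed)
  also have "\<dots> = (\<integral>\<^sup>+z. \<integral>\<^sup>+y. ennreal (\<Prod>e\<in>T. edge_weight \<phi> (placed V \<rho> z) e) *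
      ennreal (\<phi> (y - placed V \<rho> z r)) \<partial>lborel \<partial>Leb V)"
  proof (intro nn_integral_cong)
    fix z and y :: 'a
    have "placed (insert u V) \<rho> (z(u := y)) i = placed V \<rho> z i" if "i \<in> V \<union> R" for i
      using that grown_insert(2) by (auto simp: placed_def)
    then have "edge_weight \<phi> (placed (insert u V) \<rho> (z(u := y))) e = edge_weight \<phi> (placed V \<rho> z) e" if "e \<in> T" for e
      using that T by (intro edge_weight_cong[of e "V \<union> R"]) auto
    then have "(\<Prod>e\<in>T. edge_weight \<phi> (placed (insert u V) \<rho> (z(u := y))) e) = (\<Prod>e\<in>T. edge_weight \<phi> (placed V \<rho> z) e)"
      by (rule prod.cong[OF refl])
    moreover have "placed (insert u V) \<rho> (z(u := y)) r = placed V \<rho> z r" "r \<noteq> u"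
      using grown_insert by (auto simp: placed_def)
    then have "edge_weight \<phi> (placed (insert u V) \<rho> (z(u := y))) {u, r} = \<phi> (y - placed V \<rho> z r)"
      unfolding edge_weight_pair by (simp add: placed_def)
    ultimately have "(\<Prod>e\<in>insert {u, r} T. edge_weight \<phi> (placed (insert u V) \<rho> (z(u := y))) e) =
        (\<Prod>e\<in>T. edge_weight \<phi> (placed V \<rho> z) e) * \<phi> (y - placed V \<rho> z r)"
      using fin notin by simp
    then show "ennreal (\<Prod>e\<in>insert {u, r} T. edge_weight \<phi> (placed (insert u V) \<rho> (z(u := y))) e) =
      ennreal (\<Prod>e\<in>T. edge_weight \<phi> (placed V \<rho> z) e) * ennreal (\<phi> (y - placed V \<rho> z r))"
      by (simp add: ennreal_mult prod_nonneg edge_weight_bounds \<phi>_nonneg)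
  qed
  also have "\<dots> = (\<integral>\<^sup>+z. ennreal (\<Prod>e\<in>T. edge_weight \<phi> (placed V \<rho> z) e) * ?m \<partial>Leb V)"
    by (simp add: nn_integral_cmult tr)
  also have "\<dots> = (\<integral>\<^sup>+z. ennreal (\<Prod>e\<in>T. edge_weight \<phi> (placed V \<rho> z) e) \<partial>Leb V) * ?m"
    by (intro nn_integral_multc measurable_compose[OF _ measurable_ennreal] borel_measurable_prod
        measurable_edge_weight measurable_placed)
  finally show ?case using grown_insert.IH fin u by (simp add: mult.commute)
qed

lemma integrable_connected:
  assumes V: "finite V" "finite R" and H: "H \<subseteq> edges_on (V \<union> R)" and disj: "V \<inter> R = {}"
    and conn: "\<And>u. u \<in> V \<Longrightarrow> \<exists>r\<in>R. reach H S r u"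
  shows "integrable (Leb V) (\<lambda>z. \<Prod>e\<in>H. edge_weight \<phi> (placed V \<rho> z) e)"
proof (rule integrableI_bounded)
  show "(\<lambda>z. \<Prod>e\<in>H. edge_weight \<phi> (placed V \<rho> z) e) \<in> borel_measurable (Leb V)"
    by (intro borel_measurable_prod measurable_edge_weight measurable_placed)
  obtain T where T: "T \<subseteq> H" "grown_tree R T V"
    using connected_grown_tree[OF V(1) H disj conn] by metis
  have finH: "finite H" using finite_subset[OF H finite_edges_on] V by auto
  have "(\<integral>\<^sup>+z. ennreal (norm (\<Prod>e\<in>H. edge_weight \<phi> (placed V \<rho> z) e)) \<partial>Leb V) \<le>
    (\<integral>\<^sup>+z. ennreal (\<Prod>e\<in>T. edge_weight \<phi> (placed V \<rho> z) e) \<partial>Leb V)"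
  proof (intro nn_integral_mono ennreal_leI)
    fix z
    have "(\<Prod>e\<in>H. edge_weight \<phi> (placed V \<rho> z) e) =
        (\<Prod>e\<in>H - T. edge_weight \<phi> (placed V \<rho> z) e) * (\<Prod>e\<in>T. edge_weight \<phi> (placed V \<rho> z) e)"
      using prod.subset_diff[OF T(1) finH] by simp
    also have "\<dots> \<le> 1 * (\<Prod>e\<in>T. edge_weight \<phi> (placed V \<rho> z) e)"
      by (intro mult_right_mono prod_le_1 prod_nonneg) (auto simp: edge_weight_bounds)
    finally show "norm (\<Prod>e\<in>H. edge_weight \<phi> (placed V \<rho> z) e) \<le> (\<Prod>e\<in>T. edge_weight \<phi> (placed V \<rho> z) e)"
      by (simp add: prod_nonneg edge_weight_bounds)
  qed
  also have "\<dots> = (\<integral>\<^sup>+y. ennreal (\<phi> y) \<partial>lborel) ^ card V"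
    by (rule nn_integral_tree[OF T(2)])
  also have "\<dots> < \<infinity>"
    using \<phi>_integrable \<phi>_nonneg by (simp add: nn_integral_eq_integral power_less_top_ennreal)
  finally show "(\<integral>\<^sup>+z. ennreal (norm (\<Prod>e\<in>H. edge_weight \<phi> (placed V \<rho> z) e)) \<partial>Leb V) < \<infinity>" .
qed

lemma integrable_graph_sum_term:
  assumes "finite V" "a \<notin> V" "b \<notin> V" "H \<subseteq> edges_on (V \<union> {a, b})"
  shows "integrable (Leb V) (\<lambda>z. of_int (kappa_on V a b H) * (\<Prod>e\<in>H. edge_weight \<phi> (placed V \<rho> z) e))"
proof (cases "kappa_on V a b H = 0")
  case False
  have "integrable (Leb V) (\<lambda>z. \<Prod>e\<in>H. edge_weight \<phi> (placed V \<rho> z) e)"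
  proof (rule integrable_connected)
    fix u assume "u \<in> V"
    then show "\<exists>r\<in>{a, b}. reach H (V \<union> {a, b}) r u"
      using kappa_on_nonzero_connected[OF assms(1) False] by blast
  qed (use assms in auto)
  then show ?thesis by simp
qed simp

lemma integrable_graph_sum:
  assumes "finite V" "a \<notin> V" "b \<notin> V"
  shows "integrable (Leb V) (\<lambda>z. graph_sum np V a b (edge_weight \<phi> (placed V \<rho> z)))"
  unfolding graph_sum_def using assms by (intro Bochner_Integration.integrable_sum integrable_graph_sum_term) auto

text \<open>
  The vertex \<open>v\<close> may be a variable of integration (\<open>X = {v}\<close>) or a fixed point (\<open>X = {}\<close>); the
  two cases justify the two applications of Fubini's theorem when the integral is split at \<open>v\<close>.
\<close>
lemma integrable_graph_sum_product:
  assumes fin: "finite A" "finite B" and disj: "A \<inter> B = {}"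
    and distinct: "a \<noteq> v" "v \<noteq> b" "a \<noteq> b"
    and notin: "a \<notin> A" "a \<notin> B" "v \<notin> A" "v \<notin> B" "b \<notin> A" "b \<notin> B"
    and V: "V = A \<union> B \<union> X" "X \<subseteq> {v}"
  shows "integrable (Leb V) (\<lambda>z. graph_sum np A a v (edge_weight \<phi> (placed V \<rho> z)) * graph_sum np' B v b (edge_weight \<phi> (placed V \<rho> z)))"
  unfolding graph_sum_def sum_product
proof (intro Bochner_Integration.integrable_sum)
  fix H1 H2
  assume "H1 \<in> {H \<in> Pow (edges_on (A \<union> {a, v})). np \<longrightarrow> no_pivotal A a v H}"
    and "H2 \<in> {H \<in> Pow (edges_on (B \<union> {v, b})). np' \<longrightarrow> no_pivotal B v b H}"
  then interpret gluing A B a v b H1 H2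
    by unfold_locales (use fin disj distinct notin in auto)
  let ?R = "{a, v, b} - X"
  show "integrable (Leb V) (\<lambda>z. of_int (kappa_on A a v H1) * (\<Prod>e\<in>H1. edge_weight \<phi> (placed V \<rho> z) e) *
    (of_int (kappa_on B v b H2) * (\<Prod>e\<in>H2. edge_weight \<phi> (placed V \<rho> z) e)))"
  proof (cases "kappa_on A a v H1 = 0 \<or> kappa_on B v b H2 = 0")
    case False
    have "integrable (Leb V) (\<lambda>z. \<Prod>e\<in>H1 \<union> H2. edge_weight \<phi> (placed V \<rho> z) e)"
    proof (rule integrable_connected)
      have "A \<union> {a, v} \<subseteq> V \<union> ?R" "B \<union> {v, b} \<subseteq> V \<union> ?R" using V by auto
      from this[THEN edges_on_mono] show "H1 \<union> H2 \<subseteq> edges_on (V \<union> ?R)"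
        using G1 G2 by (meson Un_least subset_trans)
      fix u assume u: "u \<in> V"
      have conn1: "reach (H1 \<union> H2) UNIV a u" if "u \<in> insert v A" for u
        by (rule reach_mono[OF kappa_on_nonzero_connected[OF fin(1) _ that]]) (use False in auto)
      have conn2: "reach (H1 \<union> H2) UNIV v u" if "u \<in> insert b B" for u
        by (rule reach_mono[OF kappa_on_nonzero_connected[OF fin(2) _ that]]) (use False in auto)
      have "reach (H1 \<union> H2) UNIV a u"
      proof (cases "u \<in> B")
        case True
        then show ?thesis using reach_trans[OF conn1[of v] conn2[of u]] by simp
      next
        case False
        then show ?thesis using conn1 u V by auto
      qed
      moreover have "a \<in> ?R" using distinct V by auto
      ultimately show "\<exists>r\<in>?R. reach (H1 \<union> H2) UNIV r u" by blast
    qed (use fin V notin distinct finite_subset[OF V(2)] in auto)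
    then show ?thesis
      using finite_edges edges_disjoint by (simp add: prod.union_disjoint ac_simps)
  qed auto
qed

lemma graph_integral_cong:
  assumes "\<rho> a = \<rho>' a" "\<rho> b = \<rho>' b"
  shows "graph_integral \<phi> np V a b \<rho> = graph_integral \<phi> np V a b \<rho>'"
  unfolding graph_integral_def
  by (intro Bochner_Integration.integral_cong refl graph_sum_cong edge_weight_cong[of _ "V \<union> {a, b}"])
     (use assms in \<open>auto simp: placed_def\<close>)

text \<open>
  Measurability in the position of one end point, over which the convolution integrates.
\<close>
lemma measurable_graph_integral:
  assumes "finite V"
  shows "(\<lambda>y. graph_integral \<phi> np V a b (\<rho>(v := y))) \<in> borel_measurable borel"
proof -
  interpret finite_product_sigma_finite "\<lambda>_::nat. lborel :: 'a measure" V
    by standard fact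
  have "(\<lambda>x. placed V (\<rho>(v := fst x)) (snd x) i) \<in> borel_measurable (borel \<Otimes>\<^sub>M Leb V)" for i
  proof -
    consider "i \<in> V" | "i \<notin> V" "i = v" | "i \<notin> V" "i \<noteq> v" by blast
    then show ?thesis
    proof cases
      case 1
      then have "(\<lambda>x. snd x i) \<in> borel_measurable (borel \<Otimes>\<^sub>M Leb V)"
        by (intro measurable_compose[OF measurable_snd]) auto
      then show ?thesis using 1 by (simp add: placed_def)
    qed (simp_all add: placed_def)
  qed
  then have "(\<lambda>x. graph_sum np V a b (edge_weight \<phi> (placed V (\<rho>(v := fst x)) (snd x)))) \<in> borel_measurable (borel \<Otimes>\<^sub>M Leb V)"
    by (rule measurable_graph_sum)
  then show ?thesis
    unfolding graph_integral_def by (intro borel_measurable_lebesgue_integral) (simp add: split_def)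
qed

text \<open>
  Once the position \<open>y\<close> of \<open>v\<close> is fixed, the two factors depend on disjoint sets of variables.
\<close>
lemma integral_graph_sum_product:
  assumes fin: "finite A" "finite B" and disj: "A \<inter> B = {}"
    and distinct: "a \<noteq> v" "v \<noteq> b" "a \<noteq> b"
    and notin: "a \<notin> A" "a \<notin> B" "v \<notin> A" "v \<notin> B" "b \<notin> A" "b \<notin> B"
    and V: "V = insert v (A \<union> B)"
  shows "(\<integral>z. graph_sum np A a v (edge_weight \<phi> (placed V \<rho> z)) * graph_sum np' B v b (edge_weight \<phi> (placed V \<rho> z)) \<partial>Leb V) =
    (\<integral>y. graph_integral \<phi> np A a v (\<rho>(v := y)) * graph_integral \<phi> np' B v b (\<rho>(v := y)) \<partial>lborel)"
proof -
  define F where "F W \<rho> z = graph_sum np A a v (edge_weight \<phi> (placed W \<rho> z)) * graph_sum np' B v b (edge_weight \<phi> (placed W \<rho> z))"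
    for W \<rho> z
  let ?U = "A \<union> B"
  have V': "V = {v} \<union> ?U" using V by auto
  have inner: "(\<integral>z. F ?U \<rho>' z \<partial>Leb ?U) = graph_integral \<phi> np A a v \<rho>' * graph_integral \<phi> np' B v b \<rho>'" for \<rho>'
  proof -
    have "integrable (Leb ?U) (F ?U \<rho>')"
      unfolding F_def by (rule integrable_graph_sum_product[where X = "{}"]) (use assms in auto)
    then have "(\<integral>z. F ?U \<rho>' z \<partial>Leb ?U) = (\<integral>s. \<integral>t. F ?U \<rho>' (merge A B (s, t)) \<partial>Leb B \<partial>Leb A)"
      using disj fin by (intro lebesgue_product.product_integral_fold) auto
    also have "\<dots> = (\<integral>s. \<integral>t. graph_sum np A a v (edge_weight \<phi> (placed A \<rho>' s)) * graph_sum np' B v b (edge_weight \<phi> (placed B \<rho>' t)) \<partial>Leb B \<partial>Leb A)"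
      unfolding F_def
      by (intro Bochner_Integration.integral_cong refl arg_cong2[where f = "(*)"] graph_sum_cong;
          rule edge_weight_cong, assumption, use disj notin in \<open>auto simp: placed_def merge_def\<close>)
    also have "\<dots> = graph_integral \<phi> np A a v \<rho>' * graph_integral \<phi> np' B v b \<rho>'"
      by (simp add: graph_integral_def)
    finally show ?thesis .
  qed
  have "integrable (Leb V) (F V \<rho>)"
    unfolding F_def by (rule integrable_graph_sum_product[where X = "{v}"]) (use assms in auto)
  then have "(\<integral>z. F V \<rho> z \<partial>Leb V) = (\<integral>s. \<integral>t. F V \<rho> (merge {v} ?U (s, t)) \<partial>Leb ?U \<partial>Leb {v})"
    unfolding V' using notin fin by (intro lebesgue_product.product_integral_fold) auto
  also have "\<dots> = (\<integral>s. \<integral>t. F ?U (\<rho>(v := s v)) t \<partial>Leb ?U \<partial>Leb {v})"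
    unfolding F_def
    by (intro Bochner_Integration.integral_cong refl arg_cong2[where f = "(*)"] graph_sum_cong;
        rule edge_weight_cong, assumption, use V disj notin distinct in \<open>auto simp: placed_def merge_def\<close>)
  also have "\<dots> = (\<integral>s. graph_integral \<phi> np A a v (\<rho>(v := s v)) * graph_integral \<phi> np' B v b (\<rho>(v := s v)) \<partial>Leb {v})"
    by (simp only: inner)
  also have "\<dots> = (\<integral>y. graph_integral \<phi> np A a v (\<rho>(v := y)) * graph_integral \<phi> np' B v b (\<rho>(v := y)) \<partial>lborel)"
    by (rule lebesgue_product.product_integral_singleton[of _ v])
       (use fin in \<open>auto intro!: borel_measurable_times measurable_graph_integral\<close>)
  finally show ?thesis by (simp add: F_def)
qed

lemma graph_integral_decompose:
  assumes V: "finite V" "a \<noteq> b" "a \<notin> V" "b \<notin> V"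
  shows "graph_integral \<phi> False V a b \<rho> = graph_integral \<phi> True V a b \<rho> +
    (\<Sum>v\<in>V. \<Sum>A\<in>Pow (V - {v}).
       \<integral>y. graph_integral \<phi> False A a v (\<rho>(v := y)) * graph_integral \<phi> True (V - {v} - A) v b (\<rho>(v := y)) \<partial>lborel)"
proof -
  let ?w = "\<lambda>z. edge_weight \<phi> (placed V \<rho> z)"
  have part: "integrable (Leb V) (\<lambda>z. graph_sum False A a v (?w z) * graph_sum True (V - {v} - A) v b (?w z))"
    "(\<integral>z. graph_sum False A a v (?w z) * graph_sum True (V - {v} - A) v b (?w z) \<partial>Leb V) =
      (\<integral>y. graph_integral \<phi> False A a v (\<rho>(v := y)) * graph_integral \<phi> True (V - {v} - A) v b (\<rho>(v := y)) \<partial>lborel)"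
    if "v \<in> V" "A \<in> Pow (V - {v})" for v A
  proof -
    have *: "finite A" "finite (V - {v} - A)" "A \<inter> (V - {v} - A) = {}"
      "a \<noteq> v" "v \<noteq> b" "a \<noteq> b" "a \<notin> A" "a \<notin> V - {v} - A" "v \<notin> A" "v \<notin> V - {v} - A"
      "b \<notin> A" "b \<notin> V - {v} - A"
      using that V finite_subset[of A V] by auto
    have V': "V = insert v (A \<union> (V - {v} - A))" "V = A \<union> (V - {v} - A) \<union> {v}" using that by auto
    show "integrable (Leb V) (\<lambda>z. graph_sum False A a v (?w z) * graph_sum True (V - {v} - A) v b (?w z))"
      "(\<integral>z. graph_sum False A a v (?w z) * graph_sum True (V - {v} - A) v b (?w z) \<partial>Leb V) =
      (\<integral>y. graph_integral \<phi> False A a v (\<rho>(v := y)) * graph_integral \<phi> True (V - {v} - A) v b (\<rho>(v := y)) \<partial>lborel)"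
      by (rule integrable_graph_sum_product[OF * V'(2) order_refl], rule integral_graph_sum_product[OF * V'(1)])
  qed
  have "graph_integral \<phi> False V a b \<rho> = (\<integral>z. graph_sum True V a b (?w z) +
      (\<Sum>v\<in>V. \<Sum>A\<in>Pow (V - {v}). graph_sum False A a v (?w z) * graph_sum True (V - {v} - A) v b (?w z)) \<partial>Leb V)"
    unfolding graph_integral_def by (subst graph_sum_decompose[OF V]) (rule refl)
  also have "\<dots> = graph_integral \<phi> True V a b \<rho> + (\<Sum>v\<in>V. \<Sum>A\<in>Pow (V - {v}).
      \<integral>z. graph_sum False A a v (?w z) * graph_sum True (V - {v} - A) v b (?w z) \<partial>Leb V)"
  proof -
    have int: "integrable (Leb V)
        (\<lambda>z. \<Sum>A\<in>Pow (V - {v}). graph_sum False A a v (?w z) * graph_sum True (V - {v} - A) v b (?w z))"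
      if "v \<in> V" for v
      using part(1)[OF that] by (rule Bochner_Integration.integrable_sum)
    have "(\<integral>z. (\<Sum>v\<in>V. \<Sum>A\<in>Pow (V - {v}). graph_sum False A a v (?w z) * graph_sum True (V - {v} - A) v b (?w z)) \<partial>Leb V) =
      (\<Sum>v\<in>V. \<Sum>A\<in>Pow (V - {v}). \<integral>z. graph_sum False A a v (?w z) * graph_sum True (V - {v} - A) v b (?w z) \<partial>Leb V)"
      by (subst Bochner_Integration.integral_sum[OF int], assumption)
         (intro sum.cong refl Bochner_Integration.integral_sum part(1))
    then show ?thesis
      unfolding graph_integral_def
      by (subst Bochner_Integration.integral_add)
         (use int integrable_graph_sum[OF V(1,3,4)] in \<open>auto intro!: Bochner_Integration.integrable_sum\<close>)
  qed
  also have "\<dots> = graph_integral \<phi> True V a b \<rho> +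
    (\<Sum>v\<in>V. \<Sum>A\<in>Pow (V - {v}).
       \<integral>y. graph_integral \<phi> False A a v (\<rho>(v := y)) * graph_integral \<phi> True (V - {v} - A) v b (\<rho>(v := y)) \<partial>lborel)"
    by (intro arg_cong2[where f = "(+)"] sum.cong refl part(2))
  finally show ?thesis .
qed

text \<open>
  The end points are \<open>0\<close> at the origin and \<open>n + 1\<close> at \<open>x\<close>; the other values of the placement are
  overwritten by the variables of integration or do not occur.
\<close>
definition graph_coeff :: "bool \<Rightarrow> nat \<Rightarrow> 'a \<Rightarrow> real" where
  "graph_coeff np n x = graph_integral \<phi> np {1..n} 0 (n + 1) (\<lambda>i. if i = 0 then 0 else x)"

text \<open>
  By relabelling and translation, the integral depends only on the number of inner vertices and on
  the difference of the end points.
\<close>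
lemma graph_integral_eq_graph_coeff:
  assumes V: "finite V" "a \<noteq> b" "a \<notin> V" "b \<notin> V"
  shows "graph_integral \<phi> np V a b \<rho> = graph_coeff np (card V) (\<rho> b - \<rho> a)"
proof -
  define n where "n = card V"
  obtain h where h: "bij_betw h {1..n} V"
    using ex_bij_betw_nat_finite_1[OF V(1)] by (auto simp: n_def)
  define g where "g = h(0 := a, n + 1 := b)"
  have gV: "g ` {1..n} = V" "g 0 = a" "g (n + 1) = b"
    using bij_betw_imp_surj_on[OF h] by (auto simp: g_def image_def)
  have inj1: "inj_on g {1..n}"
    using bij_betw_imp_inj_on[OF h] inj_on_cong[of "{1..n}" g h] by (simp add: g_def)
  have W: "{1..n} \<union> {0, n + 1} = insert 0 (insert (n + 1) {1..n})" by auto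
  have inj: "inj_on g ({1..n} \<union> {0, n + 1})"
    unfolding W inj_on_insert using inj1 V gV by auto
  let ?T = "\<lambda>z. \<lambda>i\<in>{1..n}. z (g i) - \<rho> a"
  let ?\<rho> = "\<lambda>i. \<rho> (g i) - \<rho> a"
  have T: "?T \<in> Leb V \<rightarrow>\<^sub>M Leb {1..n}"
    using gV(1)
    by (intro measurable_restrict borel_measurable_diff measurable_component_singleton measurable_const)
       (auto intro!: measurable_component_singleton)
  have "graph_integral \<phi> np V a b \<rho> = (\<integral>z. graph_sum np {1..n} 0 (n + 1) (\<lambda>e. edge_weight \<phi> (placed V \<rho> z) (g ` e)) \<partial>Leb V)"
    unfolding graph_integral_def using graph_sum_relabel[OF inj, of np] gV by simp
  also have "\<dots> = (\<integral>z. graph_sum np {1..n} 0 (n + 1) (edge_weight \<phi> (placed {1..n} ?\<rho> (?T z))) \<partial>Leb V)"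
  proof (intro Bochner_Integration.integral_cong refl graph_sum_cong)
    fix z e assume "e \<in> edges_on ({1..n} \<union> {0, n + 1})"
    then obtain i j where e: "e = {i, j}" "i \<in> {1..n} \<union> {0, n + 1}" "j \<in> {1..n} \<union> {0, n + 1}"
      by (elim edges_onE)
    have "placed {1..n} ?\<rho> (?T z) k = placed V \<rho> z (g k) - \<rho> a" if "k \<in> {1..n} \<union> {0, n + 1}" for k
    proof -
      have "g k \<in> V \<longleftrightarrow> k \<in> {1..n}" using that gV V by auto
      then show ?thesis by (simp add: placed_def)
    qed
    then show "edge_weight \<phi> (placed V \<rho> z) (g ` e) = edge_weight \<phi> (placed {1..n} ?\<rho> (?T z)) e"
      using e by (simp add: edge_weight_pair)
  qed
  also have "\<dots> = (\<integral>z. graph_sum np {1..n} 0 (n + 1) (edge_weight \<phi> (placed {1..n} ?\<rho> z)) \<partial>distr (Leb V) (Leb {1..n}) ?T)"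
    by (rule integral_distr[symmetric, OF T]) (intro measurable_graph_sum measurable_placed)
  also have "distr (Leb V) (Leb {1..n}) ?T = Leb {1..n}"
    using distr_relabel_translate[OF _ inj1, of "\<rho> a"] gV(1) by simp
  also have "(\<integral>z. graph_sum np {1..n} 0 (n + 1) (edge_weight \<phi> (placed {1..n} ?\<rho> z)) \<partial>Leb {1..n}) =
      graph_coeff np n (\<rho> b - \<rho> a)"
    unfolding graph_coeff_def graph_integral_def[symmetric] by (rule graph_integral_cong) (use gV in simp_all)
  finally show ?thesis by (simp add: n_def)
qed

text \<open>
  There are \<open>m + 1\<close> choices of the last pivotal vertex and \<open>m choose j\<close> choices of the \<open>j\<close>
  inner vertices before it.
\<close>
lemma graph_coeff_decompose:
  "graph_coeff False (Suc m) x = graph_coeff True (Suc m) x +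
     (\<Sum>j\<le>m. real (Suc m) * of_nat (m choose j) * convolution (graph_coeff True (m - j)) (graph_coeff False j) x)"
proof -
  let ?V = "{1..Suc m}" and ?\<rho> = "\<lambda>i::nat. if i = 0 then 0 else x"
  have *: "(\<integral>y. graph_integral \<phi> False A 0 v (?\<rho>(v := y)) * graph_integral \<phi> True (?V - {v} - A) v (Suc m + 1) (?\<rho>(v := y)) \<partial>lborel) =
     convolution (graph_coeff True (m - card A)) (graph_coeff False (card A)) x"
    if "v \<in> ?V" "A \<in> Pow (?V - {v})" for v A
  proof -
    have A: "finite A" "A \<subseteq> ?V" "v \<notin> A" "0 \<notin> A" "0 \<noteq> v" "v \<noteq> Suc m + 1"
      using that finite_subset[of A ?V] by auto
    have card: "card (?V - {v} - A) = m - card A"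
      using that A by (subst card_Diff_subset) auto
    have "graph_integral \<phi> False A 0 v (?\<rho>(v := y)) = graph_coeff False (card A) y" for y
      using A by (subst graph_integral_eq_graph_coeff) auto
    moreover have "graph_integral \<phi> True (?V - {v} - A) v (Suc m + 1) (?\<rho>(v := y)) = graph_coeff True (m - card A) (x - y)" for y
      unfolding card[symmetric] using A by (subst graph_integral_eq_graph_coeff) auto
    ultimately show ?thesis
      unfolding convolution_def by (simp only: mult.commute)
  qed
  have "graph_coeff False (Suc m) x = graph_coeff True (Suc m) x +
    (\<Sum>v\<in>?V. \<Sum>A\<in>Pow (?V - {v}). convolution (graph_coeff True (m - card A)) (graph_coeff False (card A)) x)"
    unfolding graph_coeff_def[of _ "Suc m"]
    by (subst graph_integral_decompose, simp, simp, simp, simp, intro arg_cong2[where f = "(+)"] sum.cong refl *)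
  also have "(\<Sum>v\<in>?V. \<Sum>A\<in>Pow (?V - {v}). convolution (graph_coeff True (m - card A)) (graph_coeff False (card A)) x) =
    (\<Sum>v\<in>?V. \<Sum>j\<le>m. of_nat (m choose j) * convolution (graph_coeff True (m - j)) (graph_coeff False j) x)"
    by (intro sum.cong refl) (simp add: sum_Pow_card[where f = "\<lambda>k. convolution (graph_coeff True (m - k)) (graph_coeff False k) x"])
  finally show ?thesis by (simp add: sum_distrib_left mult.assoc)
qed

end

section \<open>Components in terms of indices\<close>

text \<open>
  The component of a point is described by quantification over the indices of the
  points. This serves two purposes: the description shows that the connection event is measurable
  even where points coincide or marks leave \<open>[0,1]\<close>, and it is easily evaluated for
  distinct points. Let \<open>U\<close> be the marks of ordered pairs of indices and \<open>z\<close> the positions.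
\<close>
lemma lex_less_irrefl: "\<not> lex_less x x"
  by (simp add: lex_less_def)

lemma lex_less_linear:
  assumes "x \<noteq> y"
  shows "lex_less x y \<longleftrightarrow> \<not> lex_less y x"
proof -
  have "{i. x $ i \<noteq> y $ i} \<noteq> {}" using assms by (auto simp: vec_eq_iff)
  define i where "i = Min {i. x $ i \<noteq> y $ i}"
  have i: "x $ i \<noteq> y $ i"
    using Min_in[OF _ \<open>{i. x $ i \<noteq> y $ i} \<noteq> {}\<close>] by (auto simp: i_def)
  have below: "x $ j = y $ j" if "j < i" for j
  proof (rule ccontr)
    assume "x $ j \<noteq> y $ j"
    then have "i \<le> j" unfolding i_def by (intro Min_le) auto
    with that show False by simp
  qed
  have *: "lex_less u w \<longleftrightarrow> u $ i < w $ i"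
    if "u $ i \<noteq> w $ i" "\<And>j. j < i \<Longrightarrow> u $ j = w $ j" for u w
    unfolding lex_less_def using that by (metis less_irrefl linorder_neqE)
  show ?thesis
    using *[of x y] *[of y x] i below by auto
qed

context
  fixes \<phi> :: "real ^ 'd::{finite,linorder} \<Rightarrow> real"
    and W :: "nat set" and z :: "nat \<Rightarrow> real ^ 'd::{finite,linorder}" and U :: "nat \<times> nat \<Rightarrow> real"
begin

text \<open>
  The mark of \<open>(p, q)\<close> is one of those attached to the two-element set \<open>{z k, z l}\<close>.
\<close>
definition index_mark :: "nat \<Rightarrow> nat \<Rightarrow> nat \<Rightarrow> nat \<Rightarrow> bool" where
  "index_mark k l p q \<longleftrightarrow> p \<in> W \<and> q \<in> W \<and> lex_less (z p) (z q) \<and>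
     (z p = z k \<and> z q = z l \<or> z p = z l \<and> z q = z k) \<and> 0 \<le> U (p, q) \<and> U (p, q) \<le> 1"

text \<open>
  Coinciding points may attach several marks to one set; exactly one atom remains if they are equal.
\<close>
definition index_simple :: "nat \<Rightarrow> nat \<Rightarrow> bool" where
  "index_simple k l \<longleftrightarrow> (\<exists>p q. index_mark k l p q \<and> (\<forall>p' q'. index_mark k l p' q' \<longrightarrow> U (p', q') = U (p, q)))"

definition index_vertex :: "nat \<Rightarrow> bool" where
  "index_vertex i \<longleftrightarrow> (\<exists>k l. k \<in> W \<and> l \<in> W \<and> (z i = z k \<or> z i = z l) \<and> index_simple k l)"

definition index_adj :: "nat \<Rightarrow> nat \<Rightarrow> bool" where
  "index_adj i j \<longleftrightarrow> i \<in> W \<and> j \<in> W \<and> z i \<noteq> z j \<and> index_vertex i \<and> index_vertex j \<and>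
     (\<exists>p q. index_mark i j p q \<and> U (p, q) \<le> \<phi> (z j - z i))"

private abbreviation "\<xi> \<equiv> marked_pairs W z U"

lemma marked_pairs_mem:
  assumes "u \<in> {0..1}"
  shows "({z k, z l}, u) \<in> \<xi> \<longleftrightarrow> (\<exists>p q. index_mark k l p q \<and> U (p, q) = u)"
proof -
  have "({z k, z l}, u) \<in> \<xi> \<longleftrightarrow>
      (\<exists>p q. {z k, z l} = {z p, z q} \<and> u = U (p, q) \<and> p \<in> W \<and> q \<in> W \<and> lex_less (z p) (z q))"
    unfolding marked_pairs_def by simp
  also have "\<dots> \<longleftrightarrow> (\<exists>p q. index_mark k l p q \<and> U (p, q) = u)"
    unfolding index_mark_def doubleton_eq_iff using assms by (intro iff_exI) auto
  finally show ?thesis .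
qed

lemma index_mark_range: "index_mark k l p q \<Longrightarrow> U (p, q) \<in> {0..1}"
  by (simp add: index_mark_def)

lemma index_simple_iff: "card (\<xi> \<inter> ({{z k, z l}} \<times> {0..1})) = 1 \<longleftrightarrow> index_simple k l"
proof -
  have "\<xi> \<inter> ({{z k, z l}} \<times> {0..1}) = Pair {z k, z l} ` {u. \<exists>p q. index_mark k l p q \<and> U (p, q) = u}"
    using marked_pairs_mem index_mark_range by (auto simp del: atLeastAtMost_iff; blast)
  then have "card (\<xi> \<inter> ({{z k, z l}} \<times> {0..1})) = card {u. \<exists>p q. index_mark k l p q \<and> U (p, q) = u}"
    by (simp add: card_image inj_on_def)
  then show ?thesis
    unfolding index_simple_def by (auto simp: card_1_singleton_iff set_eq_iff) metis+
qed

lemma rcm_vertexE: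
  assumes "y \<in> rcm_vertices \<xi>"
  obtains k l where "k \<in> W" "l \<in> W" "y = z k \<or> y = z l" "index_simple k l"
proof -
  from assms obtain e where e: "y \<in> e" "card (\<xi> \<inter> ({e} \<times> {0..1})) = 1"
    by (auto simp: rcm_vertices_def)
  from e(2) have "\<xi> \<inter> ({e} \<times> {0..1}) \<noteq> {}" by (metis card.empty zero_neq_one)
  then obtain k l where "k \<in> W" "l \<in> W" "e = {z k, z l}"
    by (auto simp: marked_pairs_def)
  with e that show ?thesis using index_simple_iff by auto
qed

lemma rcm_vertices_iff: "z i \<in> rcm_vertices \<xi> \<longleftrightarrow> index_vertex i"
proof
  assume "z i \<in> rcm_vertices \<xi>"
  then show "index_vertex i" by (elim rcm_vertexE) (auto simp: index_vertex_def)
next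
  assume "index_vertex i"
  then obtain k l where "z i = z k \<or> z i = z l" "index_simple k l" by (auto simp: index_vertex_def)
  then have "z i \<in> {z k, z l}" "card (\<xi> \<inter> ({{z k, z l}} \<times> {0..1})) = 1" using index_simple_iff by auto
  then show "z i \<in> rcm_vertices \<xi>" unfolding rcm_vertices_def by blast
qed

lemma rcm_edges_iff:
  assumes sym: "\<And>y. \<phi> (- y) = \<phi> y" and ij: "i \<in> W" "j \<in> W"
  shows "{z i, z j} \<in> rcm_edges \<phi> \<xi> \<longleftrightarrow> index_adj i j"
proof -
  have single: "card (\<xi> \<inter> {(e, u)}) = 1 \<longleftrightarrow> (e, u) \<in> \<xi>" for e u
    by (cases "(e, u) \<in> \<xi>") auto
  have mark: "(\<exists>u\<in>{0..1}. ({z i, z j}, u) \<in> \<xi> \<and> u \<le> c) \<longleftrightarrow>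
      (\<exists>p q. index_mark i j p q \<and> U (p, q) \<le> c)" for c
    using marked_pairs_mem[of _ i j] index_mark_range[of i j] by metis
  have swap: "\<phi> (z i - z j) = \<phi> (z j - z i)"
    using sym[of "z j - z i"] by simp
  have "{z i, z j} \<in> rcm_edges \<phi> \<xi> \<longleftrightarrow> z i \<noteq> z j \<and> z i \<in> rcm_vertices \<xi> \<and> z j \<in> rcm_vertices \<xi> \<and>
      (\<exists>u\<in>{0..1}. ({z i, z j}, u) \<in> \<xi> \<and> u \<le> \<phi> (z j - z i))"
    unfolding rcm_edges_def single mem_Collect_eq
  proof (intro iffI)
    assume "\<exists>y w. {z i, z j} = {y, w} \<and> y \<noteq> w \<and> y \<in> rcm_vertices \<xi> \<and> w \<in> rcm_vertices \<xi> \<and>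
      (\<exists>u\<in>{0..1}. ({y, w}, u) \<in> \<xi> \<and> u \<le> \<phi> (w - y))"
    then obtain y w where *: "{z i, z j} = {y, w}" "y \<noteq> w" "y \<in> rcm_vertices \<xi>" "w \<in> rcm_vertices \<xi>"
      "\<exists>u\<in>{0..1}. ({y, w}, u) \<in> \<xi> \<and> u \<le> \<phi> (w - y)" by blast
    from *(1) consider "y = z i" "w = z j" | "y = z j" "w = z i" by (auto simp: doubleton_eq_iff)
    then show "z i \<noteq> z j \<and> z i \<in> rcm_vertices \<xi> \<and> z j \<in> rcm_vertices \<xi> \<and>
      (\<exists>u\<in>{0..1}. ({z i, z j}, u) \<in> \<xi> \<and> u \<le> \<phi> (z j - z i))"
      using * swap by cases (auto simp: insert_commute)
  qed blast
  then show ?thesis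
    unfolding mark rcm_vertices_iff index_adj_def using ij by simp
qed

lemma rcm_component_iff:
  assumes sym: "\<And>y. \<phi> (- y) = \<phi> y" and a: "a \<in> W"
  shows "x \<in> rcm_component \<phi> (z a) \<xi> \<longleftrightarrow>
    (if index_vertex a then \<exists>i\<in>W. z i = x \<and> index_adj\<^sup>*\<^sup>* a i else z a = x)"
proof -
  let ?E = "rcm_edges \<phi> \<xi>"
  have "(\<exists>p. is_path ?E (z a) p x) \<longleftrightarrow> reach ?E UNIV (z a) x"
    using is_path_imp_reach[of ?E "z a" _ x UNIV] reach_imp_is_path[of ?E UNIV "z a" x] by auto
  also have "\<dots> \<longleftrightarrow> (\<exists>i\<in>W. z i = x \<and> index_adj\<^sup>*\<^sup>* a i)"
  proof
    assume "reach ?E UNIV (z a) x"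
    then show "\<exists>i\<in>W. z i = x \<and> index_adj\<^sup>*\<^sup>* a i"
    proof (induction rule: reach_induct)
      case base
      then show ?case using a by blast
    next
      case (step x y)
      then obtain i where i: "i \<in> W" "z i = x" "index_adj\<^sup>*\<^sup>* a i" by blast
      have "y \<in> rcm_vertices \<xi>"
        using step(2) by (auto simp: rcm_edges_def doubleton_eq_iff)
      then obtain j where j: "j \<in> W" "z j = y" by (elim rcm_vertexE) auto
      have "index_adj i j" using step(2) i j rcm_edges_iff[OF sym, of i j] by simp
      with i j show ?case by (blast intro: rtranclp.rtrancl_into_rtrancl)
    qed
  next
    assume "\<exists>i\<in>W. z i = x \<and> index_adj\<^sup>*\<^sup>* a i"
    then obtain i where i: "z i = x" "index_adj\<^sup>*\<^sup>* a i" by blast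
    from i(2) have "reach ?E UNIV (z a) (z i)"
    proof (induction rule: rtranclp_induct)
      case (step i j)
      then have "{z i, z j} \<in> ?E"
        using rcm_edges_iff[OF sym, of i j] by (auto simp: index_adj_def)
      then have "reach ?E UNIV (z i) (z j)" by (intro reach_edge) auto
      with step show ?case by (blast intro: reach_trans)
    qed simp
    then show "reach ?E UNIV (z a) x" using i by simp
  qed
  finally show ?thesis
    unfolding rcm_component_def using rcm_vertices_iff[of a] by auto
qed

end

lemma measurable_lex_less:
  assumes [measurable]: "f \<in> borel_measurable M" "g \<in> borel_measurable M"
  shows "Measurable.pred M (\<lambda>\<omega>. lex_less (f \<omega>) (g \<omega> :: real ^ 'd::{finite,linorder}))"
proof -
  have [measurable]: "(\<lambda>v :: real ^ 'd::{finite,linorder}. v $ i) \<in> borel_measurable borel" for i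
    by (intro borel_measurable_continuous_onI continuous_intros)
  show ?thesis unfolding lex_less_def by measurable
qed

lemma measurable_rtranclp:
  fixes R :: "'m \<Rightarrow> 'i::countable \<Rightarrow> 'i \<Rightarrow> bool"
  assumes [measurable]: "\<And>i j. Measurable.pred M (\<lambda>\<omega>. R \<omega> i j)"
  shows "Measurable.pred M (\<lambda>\<omega>. (R \<omega>)\<^sup>*\<^sup>* i j)"
proof -
  have [measurable]: "Measurable.pred M (\<lambda>\<omega>. (R \<omega> ^^ k) i j)" for k j
  proof (induction k arbitrary: j)
    case (Suc k)
    note [measurable] = Suc.IH
    have "(\<lambda>\<omega>. (R \<omega> ^^ Suc k) i j) = (\<lambda>\<omega>. \<exists>l. (R \<omega> ^^ k) i l \<and> R \<omega> l j)"
      by (auto simp: fun_eq_iff relcompp_apply)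
    then show ?case by simp
  qed simp
  have "(\<lambda>\<omega>. (R \<omega>)\<^sup>*\<^sup>* i j) = (\<lambda>\<omega>. \<exists>k. (R \<omega> ^^ k) i j)"
    by (auto simp: rtranclp_is_Sup_relpowp)
  then show ?thesis by simp
qed

text \<open>
  All index-level conditions are countable combinations of comparisons between coordinates
  and marks. Marks of pairs outside \<open>W\<close> are not assumed to be measurable, so they are replaced by \<open>0\<close>.
\<close>
lemma measurable_rcm_component:
  fixes \<phi> :: "real ^ 'd::{finite,linorder} \<Rightarrow> real"
    and z :: "'m \<Rightarrow> nat \<Rightarrow> real ^ 'd::{finite,linorder}" and U :: "'m \<Rightarrow> nat \<times> nat \<Rightarrow> real"
  assumes [measurable]: "\<phi> \<in> borel_measurable borel" and sym: "\<And>y. \<phi> (- y) = \<phi> y"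
    and [measurable]: "\<And>i. (\<lambda>\<omega>. z \<omega> i) \<in> borel_measurable M"
    and U: "\<And>p q. p \<in> W \<Longrightarrow> q \<in> W \<Longrightarrow> (\<lambda>\<omega>. U \<omega> (p, q)) \<in> borel_measurable M"
    and a: "a \<in> W"
  shows "Measurable.pred M (\<lambda>\<omega>. x \<in> rcm_component \<phi> (z \<omega> a) (marked_pairs W (z \<omega>) (U \<omega>)))"
proof -
  define V where "V \<omega> pq = (if fst pq \<in> W \<and> snd pq \<in> W then U \<omega> pq else 0)" for \<omega> pq
  have [measurable]: "(\<lambda>\<omega>. V \<omega> (p, q)) \<in> borel_measurable M" for p q
    using U by (cases "p \<in> W \<and> q \<in> W") (auto simp: V_def)
  have VU: "marked_pairs W (z \<omega>) (U \<omega>) = marked_pairs W (z \<omega>) (V \<omega>)" for \<omega>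
    unfolding marked_pairs_def by (intro Collect_cong iff_exI) (auto simp: V_def)
  note measurable_lex_less [measurable]
  have [measurable]: "Measurable.pred M (\<lambda>\<omega>. index_mark W (z \<omega>) (V \<omega>) k l p q)" for k l p q
    unfolding index_mark_def by measurable
  have [measurable]: "Measurable.pred M (\<lambda>\<omega>. index_simple W (z \<omega>) (V \<omega>) k l)" for k l
    unfolding index_simple_def by measurable
  have [measurable]: "Measurable.pred M (\<lambda>\<omega>. index_vertex W (z \<omega>) (V \<omega>) i)" for i
    unfolding index_vertex_def by measurable
  have [measurable]: "Measurable.pred M (\<lambda>\<omega>. index_adj \<phi> W (z \<omega>) (V \<omega>) i j)" for i j
    unfolding index_adj_def by measurable
  note measurable_rtranclp [measurable]
  show ?thesis
    unfolding VU rcm_component_iff[of \<phi>, OF sym a] by measurable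
qed

section \<open>Expectations over the marks\<close>

text \<open>
  Moebius inversion on the subsets of \<open>G\<close>.
\<close>
lemma pi_on_eq_sum_kappa_on:
  assumes "finite G"
  shows "pi_on V a b G = (\<Sum>H\<in>Pow G. kappa_on V a b H)"
proof -
  define g where "g H = (\<Sum>T\<in>Pow H. (-1) ^ card T * pi_on V a b T)" for H
  have "pi_on V a b G = (\<Sum>H\<in>Pow G. (-1) ^ card H * g H)"
    by (rule inclusion_exclusion_symmetric) (simp_all add: g_def assms)
  also have "\<dots> = (\<Sum>H\<in>Pow G. kappa_on V a b H)"
  proof (intro sum.cong refl)
    fix H assume "H \<in> Pow G"
    then have fin: "finite H" using assms by (auto intro: finite_subset)
    have sgn: "(-1 :: int) ^ card H * (-1) ^ card T = (-1) ^ (card H - card T)" if "T \<subseteq> H" for T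
      using card_mono[OF fin that] by (simp add: neg_one_power_add_eq_neg_one_power_diff flip: power_add)
    have "(-1) ^ card H * ((-1) ^ card T * pi_on V a b T) = pi_on V a b T * (-1) ^ (card H - card T)"
      if "T \<in> Pow H" for T
      unfolding sgn[OF PowD[OF that], symmetric] by (simp only: mult_ac)
    then show "(-1) ^ card H * g H = kappa_on V a b H"
      unfolding g_def kappa_on_def sum_distrib_left by (rule sum.cong[OF refl])
  qed
  finally show ?thesis .
qed

abbreviation uniform01 :: "real measure" where
  "uniform01 \<equiv> uniform_measure lborel {0..1}"

lemma prob_space_uniform01: "prob_space uniform01"
  by (rule prob_space_uniform_measure) auto

lemma prob_uniform01_atMost: "0 \<le> c \<Longrightarrow> c \<le> 1 \<Longrightarrow> measure uniform01 {..c} = c"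
proof -
  assume c: "0 \<le> c" "c \<le> 1"
  then have "{0..1} \<inter> {..c} = {0..c}" by auto
  then show ?thesis using c by simp
qed

text \<open>
  The ordered pair of indices whose mark decides about the edge: the lexicographically smaller
  point comes first. For coinciding points any of the two orders will do.
\<close>
definition mark_index :: "(nat \<Rightarrow> real ^ 'd::{finite,linorder}) \<Rightarrow> nat set \<Rightarrow> nat \<times> nat" where
  "mark_index z e = (if lex_less (z (Min e)) (z (Max e)) then (Min e, Max e) else (Max e, Min e))"

lemma mark_index_edge:
  assumes "e \<in> edges_on W"
  shows "e = {fst (mark_index z e), snd (mark_index z e)}" "mark_index z e \<in> W \<times> W"
  using assms by (auto elim!: edges_onE simp: mark_index_def min_def max_def split: if_splits)

lemma mark_index_pair:
  assumes "i \<noteq> j" "lex_less (z i) (z j)"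
  shows "mark_index z {i, j} = (i, j)"
proof -
  have "\<not> lex_less (z j) (z i)"
    using assms lex_less_linear[of "z i" "z j"] lex_less_irrefl by metis
  then show ?thesis using assms by (auto simp: mark_index_def min_def max_def)
qed

text \<open>
  The lexicographic order ties the model to \<open>\<real>\<^sup>d\<close>, while the integrals above make sense in any
  Euclidean space.
\<close>
locale rcm_function = connection_function \<phi>
  for \<phi> :: "real ^ 'd::{finite,linorder} \<Rightarrow> real"
begin

definition random_graph :: "nat \<Rightarrow> (nat \<Rightarrow> real ^ 'd::{finite,linorder}) \<Rightarrow> (nat \<times> nat \<Rightarrow> real) \<Rightarrow> nat set set" where
  "random_graph n z U = {e \<in> edges_on {0..n+1}. U (mark_index z e) \<le> edge_weight \<phi> z e}"

text \<open>
  Distinct edges are decided by distinct marks, hence independently.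
\<close>
lemma prob_edges_present:
  assumes H: "H \<subseteq> edges_on {0..n+1}"
  shows "integrable (mark_space n) (\<lambda>U. of_bool (H \<subseteq> random_graph n z U) :: real)"
    and "(\<integral>U. of_bool (H \<subseteq> random_graph n z U) \<partial>mark_space n) = (\<Prod>e\<in>H. edge_weight \<phi> z e)"
proof -
  interpret product_prob_space "\<lambda>_. uniform01" "{0..n+1} \<times> {0..n+1}"
    by (intro product_prob_spaceI prob_space_uniform01)
  let ?I = "{0..n+1} \<times> {0..n+1}"
  have finH: "finite H" using finite_subset[OF H finite_edges_on] by simp
  have inj: "inj_on (mark_index z) H"
    by (rule inj_onI) (metis mark_index_edge(1) H subsetD)
  have sub: "mark_index z ` H \<subseteq> ?I" using mark_index_edge(2) H by blast
  define c where "c p = edge_weight \<phi> z {fst p, snd p}" for p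
  have c: "c (mark_index z e) = edge_weight \<phi> z e" if "e \<in> H" for e
    using mark_index_edge(1)[of e "{0..n+1}" z] that H by (auto simp: c_def)
  define f where "f p u = (if p \<in> mark_index z ` H then indicator {..c p} u else (1 :: real))" for p u
  have eq: "of_bool (H \<subseteq> random_graph n z U) = (\<Prod>p\<in>?I. f p (U p))" for U
  proof -
    have "of_bool (H \<subseteq> random_graph n z U) = (\<Prod>e\<in>H. of_bool (U (mark_index z e) \<le> edge_weight \<phi> z e) :: real)"
      using H finH by (auto simp: random_graph_def prod_zero_iff subset_iff)
    also have "\<dots> = (\<Prod>e\<in>H. f (mark_index z e) (U (mark_index z e)))"
      by (intro prod.cong refl) (auto simp: f_def c indicator_def)
    also have "\<dots> = (\<Prod>p\<in>mark_index z ` H. f p (U p))"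
      by (simp add: prod.reindex[OF inj])
    also have "\<dots> = (\<Prod>p\<in>?I. f p (U p))"
      by (rule prod.mono_neutral_left) (use sub in \<open>auto simp: f_def\<close>)
    finally show ?thesis .
  qed
  have int_f: "integrable uniform01 (f p)" for p
    unfolding f_def using prob_space_uniform01
    by (cases "p \<in> mark_index z ` H")
       (auto intro!: finite_measure.integrable_const_bound[where B = 1] prob_space.finite_measure)
  show "integrable (mark_space n) (\<lambda>U. of_bool (H \<subseteq> random_graph n z U) :: real)"
    unfolding eq mark_space_def by (rule product_integrable_prod) (auto intro: int_f)
  have "(\<integral>U. of_bool (H \<subseteq> random_graph n z U) \<partial>mark_space n) = (\<Prod>p\<in>?I. \<integral>u. f p u \<partial>uniform01)"
    unfolding eq mark_space_def by (rule product_integral_prod) (auto intro: int_f)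
  also have "\<dots> = (\<Prod>p\<in>mark_index z ` H. \<integral>u. f p u \<partial>uniform01)"
    using prob_space.prob_space[OF prob_space_uniform01] sub
    by (intro prod.mono_neutral_right) (auto simp: f_def)
  also have "\<dots> = (\<Prod>e\<in>H. \<integral>u. f (mark_index z e) u \<partial>uniform01)"
    by (simp add: prod.reindex[OF inj])
  also have "\<dots> = (\<Prod>e\<in>H. edge_weight \<phi> z e)"
    by (intro prod.cong refl) (auto simp: f_def c prob_uniform01_atMost edge_weight_bounds)
  finally show "(\<integral>U. of_bool (H \<subseteq> random_graph n z U) \<partial>mark_space n) = (\<Prod>e\<in>H. edge_weight \<phi> z e)" .
qed

lemma expectation_pi_on:
  shows "integrable (mark_space n) (\<lambda>U. real_of_int (pi_on {1..n} 0 (n+1) (random_graph n z U)))" (is ?int)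
    and "(\<integral>U. real_of_int (pi_on {1..n} 0 (n+1) (random_graph n z U)) \<partial>mark_space n) =
      graph_sum False {1..n} 0 (n+1) (edge_weight \<phi> z)" (is ?eq)
proof -
  have W: "{1..n} \<union> {0, n + 1} = {0..n+1}" by auto
  let ?E = "edges_on {0..n+1}"
  have finE: "finite (Pow ?E)" by (simp add: finite_edges_on)
  have eq: "real_of_int (pi_on {1..n} 0 (n+1) (random_graph n z U)) =
      (\<Sum>H\<in>Pow ?E. real_of_int (kappa_on {1..n} 0 (n+1) H) * of_bool (H \<subseteq> random_graph n z U))" for U
  proof -
    have sub: "random_graph n z U \<subseteq> ?E" by (auto simp: random_graph_def)
    then have "finite (random_graph n z U)" by (rule finite_subset) (simp add: finite_edges_on)
    then have "real_of_int (pi_on {1..n} 0 (n+1) (random_graph n z U)) =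
        (\<Sum>H\<in>Pow (random_graph n z U). real_of_int (kappa_on {1..n} 0 (n+1) H) * of_bool (H \<subseteq> random_graph n z U))"
      by (simp add: pi_on_eq_sum_kappa_on)
    also have "\<dots> = (\<Sum>H\<in>Pow ?E. real_of_int (kappa_on {1..n} 0 (n+1) H) * of_bool (H \<subseteq> random_graph n z U))"
      by (rule sum.mono_neutral_left[OF finE]) (use sub in auto)
    finally show ?thesis .
  qed
  show ?int
    unfolding eq by (intro Bochner_Integration.integrable_sum integrable_mult_right prob_edges_present) auto
  have "(\<integral>U. real_of_int (pi_on {1..n} 0 (n+1) (random_graph n z U)) \<partial>mark_space n) =
    (\<Sum>H\<in>Pow ?E. real_of_int (kappa_on {1..n} 0 (n+1) H) * (\<integral>U. of_bool (H \<subseteq> random_graph n z U) \<partial>mark_space n))"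
    unfolding eq
    by (subst Bochner_Integration.integral_sum)
       (auto intro!: integrable_mult_right prob_edges_present)
  also have "\<dots> = graph_sum False {1..n} 0 (n+1) (edge_weight \<phi> z)"
    unfolding graph_sum_def W by (intro sum.cong) (auto simp: prob_edges_present(2))
  finally show ?eq .
qed

text \<open>
  For \<open>x = 0\<close> the first and the last point coincide and \<open>x\<close> belongs to the component of \<open>0\<close> for
  trivial reasons. The index graph agrees with this if the edge \<open>{0, n + 1}\<close>, of weight \<open>\<phi> 0\<close>,
  is always present, that is, if \<open>\<phi> 0 = 1\<close>.
\<close>
lemma connects_iff_reach:
  assumes U: "\<And>p q. p \<le> n + 1 \<Longrightarrow> q \<le> n + 1 \<Longrightarrow> 0 \<le> U (p, q) \<and> U (p, q) \<le> 1"
    and J: "J \<subseteq> {1..n}"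
    and z: "inj_on (pts n xs x) {0..n+1} \<or> x = 0 \<and> \<phi> 0 = 1"
  shows "connects \<phi> n J xs x U \<longleftrightarrow> reach (random_graph n (pts n xs x) U) (J \<union> {0, n+1}) 0 (n+1)"
proof -
  define z where "z = pts n xs x"
  define W where "W = {0} \<union> J \<union> {n+1}"
  have W: "0 \<in> W" "n + 1 \<in> W" "W \<subseteq> {0..n+1}" "W = J \<union> {0, n+1}" using J by (auto simp: W_def)
  have ends: "z 0 = 0" "z (n + 1) = x" by (auto simp: z_def pts_def)
  have "connects \<phi> n J xs x U \<longleftrightarrow> x \<in> rcm_component \<phi> (z 0) (marked_pairs W z U)"
    by (simp add: connects_def W_def z_def[symmetric] ends)
  also have "\<dots> \<longleftrightarrow> (if index_vertex W z U 0 then \<exists>i\<in>W. z i = x \<and> (index_adj \<phi> W z U)\<^sup>*\<^sup>* 0 i else z 0 = x)"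
    by (rule rcm_component_iff[of \<phi>, OF \<phi>_sym W(1)])
  also have "\<dots> \<longleftrightarrow> reach (random_graph n z U) W 0 (n+1)"
    using z
  proof
    assume inj: "inj_on (pts n xs x) {0..n+1}"
    have z_eq: "z i = z j \<longleftrightarrow> i = j" if "i \<in> W" "j \<in> W" for i j
      using inj_on_eq_iff[OF inj, of i j] that W(3)[THEN subsetD] unfolding z_def by blast
    have U': "0 \<le> U (p, q) \<and> U (p, q) \<le> 1" if "p \<in> W" "q \<in> W" for p q
      using U that W(3) by (auto simp: subset_iff)
    have mark: "index_mark W z U k l p q \<longleftrightarrow> (p, q) = mark_index z {k, l}" if "k \<in> W" "l \<in> W" "k \<noteq> l" for k l p q
    proof -
      have "z k \<noteq> z l" using z_eq that by auto
      then consider "lex_less (z k) (z l)" "\<not> lex_less (z l) (z k)" | "lex_less (z l) (z k)" "\<not> lex_less (z k) (z l)"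
        using lex_less_linear by blast
      then show ?thesis
      proof cases
        case 1
        then have "mark_index z {k, l} = (k, l)" using that by (intro mark_index_pair)
        then show ?thesis using 1 that z_eq U' by (auto simp: index_mark_def)
      next
        case 2
        then have "mark_index z {k, l} = (l, k)" using that mark_index_pair[of l k z] by (simp add: insert_commute)
        then show ?thesis using 2 that z_eq U' by (auto simp: index_mark_def)
      qed
    qed
    have simple: "index_simple W z U k l" if "k \<in> W" "l \<in> W" "k \<noteq> l" for k l
      unfolding index_simple_def mark[OF that] by (metis surj_pair)
    have vert: "index_vertex W z U i" if "i \<in> W" for i
    proof -
      obtain j where "j \<in> W" "j \<noteq> i" using W(1,2) by (metis add_is_0 one_neq_zero)
      then show ?thesis using simple[of i j] that by (auto simp: index_vertex_def)
    qed
    have adj: "index_adj \<phi> W z U i j \<longleftrightarrow> {i, j} \<in> random_graph n z U \<and> i \<in> W \<and> j \<in> W" for i j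
    proof (cases "i \<in> W \<and> j \<in> W \<and> i \<noteq> j")
      case True
      then have "(\<exists>p q. index_mark W z U i j p q \<and> U (p, q) \<le> c) \<longleftrightarrow> U (mark_index z {i, j}) \<le> c" for c
        using mark[of i j] by (metis surj_pair)
      moreover have "edge_weight \<phi> z {i, j} = \<phi> (z j - z i)"
        using edge_weight_pair[of z j i] by (simp add: insert_commute)
      moreover have "{i, j} \<in> edges_on {0..n+1}" using True W(3) unfolding doubleton_edges_on by blast
      ultimately show ?thesis
        using True z_eq vert by (simp add: index_adj_def random_graph_def)
    next
      case False
      then show ?thesis by (auto simp: index_adj_def random_graph_def doubleton_edges_on)
    qed
    have "z i = x \<longleftrightarrow> i = n + 1" if "i \<in> W" for i
      using z_eq[OF that W(2)] ends by simp
    then have "(\<exists>i\<in>W. z i = x \<and> (index_adj \<phi> W z U)\<^sup>*\<^sup>* 0 i) \<longleftrightarrow> (index_adj \<phi> W z U)\<^sup>*\<^sup>* 0 (n+1)"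
      using W(2) by auto
    then show ?thesis using vert[OF W(1)] by (simp add: reach_def adj[abs_def])
  next
    assume x: "x = 0 \<and> \<phi> 0 = 1"
    have "edge_weight \<phi> z {0, n+1} = 1" unfolding edge_weight_pair using x ends by simp
    moreover have "mark_index z {0, n+1} \<in> {0..n+1} \<times> {0..n+1}"
      by (rule mark_index_edge) (simp add: doubleton_edges_on)
    then have "U (mark_index z {0, n+1}) \<le> 1" using U by (cases "mark_index z {0, n+1}") auto
    moreover have "{0, n+1} \<in> edges_on {0..n+1}" by (simp add: doubleton_edges_on)
    ultimately have "{0, n+1} \<in> random_graph n z U" by (simp add: random_graph_def)
    then have "reach (random_graph n z U) W 0 (n+1)" using W by (intro reach_edge)
    moreover have "\<exists>i\<in>W. z i = x \<and> (index_adj \<phi> W z U)\<^sup>*\<^sup>* 0 i" using W(1) ends x by auto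
    ultimately show ?thesis using ends x by auto
  qed
  finally show ?thesis unfolding W(4) z_def .
qed

text \<open>
  For fixed values of the other coordinates only one value of the coordinate \<open>i\<close> is excluded.
\<close>
lemma AE_points_distinct:
  fixes \<rho> :: "nat \<Rightarrow> real ^ 'd::{finite,linorder}"
  assumes V: "finite V" "i \<in> V" "i \<noteq> j"
  shows "AE z in Leb V. placed V \<rho> z i \<noteq> placed V \<rho> z j"
proof -
  define V' where "V' = V - {i}"
  have V': "V = insert i V'" "finite V'" "i \<notin> V'" using V by (auto simp: V'_def)
  let ?N = "{z \<in> space (Leb V). placed V \<rho> z i = placed V \<rho> z j}"
  have N: "?N \<in> sets (Leb V)"
    using measurable_placed[of V \<rho> i] measurable_placed[of V \<rho> j] by measurable
  have "emeasure (Leb V) ?N = (\<integral>\<^sup>+z. indicator ?N z \<partial>Leb (insert i V'))"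
    using N V' by simp
  also have "\<dots> = (\<integral>\<^sup>+z. \<integral>\<^sup>+y. indicator ?N (z(i := y)) \<partial>lborel \<partial>Leb V')"
  proof (rule lebesgue_product.product_nn_integral_insert[OF V'(2,3)])
    show "indicator ?N \<in> borel_measurable (Leb (insert i V'))"
      using N unfolding V'(1)[symmetric] by (rule borel_measurable_indicator)
  qed
  also have "\<dots> \<le> (\<integral>\<^sup>+z. \<integral>\<^sup>+y. indicator {placed V' \<rho> z j} y \<partial>lborel \<partial>Leb V')"
    using V' V(3) by (intro nn_integral_mono) (auto simp: indicator_def placed_def)
  also have "\<dots> = 0" by simp
  finally have "emeasure (Leb V) ?N = 0" by simp
  then have "?N \<in> null_sets (Leb V)" using N by (intro null_setsI)
  then show ?thesis by (rule AE_I'[where N = ?N]) auto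
qed

lemma pts_eq_placed:
  assumes "i \<le> n + 1"
  shows "pts n xs x i = placed {1..n} (\<lambda>i. if i = 0 then 0 else x) xs i"
  using assms by (auto simp: pts_def placed_def)

lemma AE_pts_inj:
  fixes x :: "real ^ 'd::{finite,linorder}"
  assumes "x \<noteq> 0"
  shows "AE xs in Leb {1..n}. inj_on (pts n xs x) {0..n+1}"
proof -
  let ?z = "\<lambda>xs. placed {1..n} (\<lambda>i. if i = 0 then 0 else x) xs"
  have "AE xs in Leb {1..n}. i \<noteq> j \<longrightarrow> ?z xs i \<noteq> ?z xs j" if "i \<le> n + 1" "j \<le> n + 1" for i j
  proof -
    let ?\<rho> = "\<lambda>i::nat. if i = 0 then 0 else x"
    have "i \<in> {1..n} \<or> i \<in> {0, n+1}" "j \<in> {1..n} \<or> j \<in> {0, n+1}"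
      using that by auto
    then consider "i = j" | "i \<noteq> j" "i \<in> {1..n}" | "i \<noteq> j" "j \<in> {1..n}"
      | "i \<noteq> j" "i \<in> {0, n+1}" "j \<in> {0, n+1}"
      by blast
    then show ?thesis
    proof cases
      case 2
      then show ?thesis
        using AE_points_distinct[of "{1..n}" i j ?\<rho>] by simp
    next
      case 3
      then have "AE xs in Leb {1..n}. ?z xs j \<noteq> ?z xs i"
        by (intro AE_points_distinct) auto
      then show ?thesis by (rule eventually_mono) simp
    next
      case 4
      then show ?thesis using assms by (auto simp: placed_def)
    qed simp
  qed
  then have "AE xs in Leb {1..n}. \<forall>i\<in>{0..n+1}. \<forall>j\<in>{0..n+1}. i \<noteq> j \<longrightarrow> ?z xs i \<noteq> ?z xs j"
    by (intro eventually_ball_finite ballI) auto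
  then show ?thesis
    by (rule eventually_mono) (auto simp: inj_on_def pts_eq_placed)
qed

lemma AE_marks: "AE U in mark_space n. \<forall>p q. p \<le> n + 1 \<longrightarrow> q \<le> n + 1 \<longrightarrow> 0 \<le> U (p, q) \<and> U (p, q) \<le> 1"
proof -
  have "AE u in uniform01. 0 \<le> u \<and> u \<le> 1"
    by (rule AE_uniform_measureI) auto
  then have "AE U in mark_space n. \<forall>p\<in>{0..n+1} \<times> {0..n+1}. 0 \<le> U p \<and> U p \<le> 1"
    unfolding mark_space_def
    by (intro eventually_ball_finite ballI AE_PiM_component prob_space_uniform01) auto
  then show ?thesis by (rule eventually_mono) auto
qed

lemma measurable_mark:
  assumes "p \<in> {0..n+1} \<times> {0..n+1}"
  shows "(\<lambda>U. U p) \<in> borel_measurable (mark_space n)"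
  using measurable_component_singleton[OF assms, of "\<lambda>_. uniform01"]
  by (simp add: mark_space_def cong: measurable_cong_sets)

lemma measurable_connects:
  assumes J: "J \<subseteq> {1..n}"
  shows "Measurable.pred (Leb {1..n} \<Otimes>\<^sub>M mark_space n) (\<lambda>(xs, U). connects \<phi> n J xs x U)"
    and "Measurable.pred (mark_space n) (\<lambda>U. connects \<phi> n J xs x U)"
proof -
  define W where "W = {0} \<union> J \<union> {n+1}"
  define z where "z xs = placed {1..n} (\<lambda>i. if i = 0 then 0 else x) xs" for xs
  have W: "0 \<in> W" "W \<subseteq> {0..n+1}" using J by (auto simp: W_def)
  have conn: "connects \<phi> n J xs x U \<longleftrightarrow> x \<in> rcm_component \<phi> (z xs 0) (marked_pairs W (z xs) U)" for xs U
  proof -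
    have "pts n xs x i = z xs i" if "i \<in> W" for i
      using that W(2) unfolding z_def by (intro pts_eq_placed) auto
    then have "marked_pairs W (pts n xs x) U = marked_pairs W (z xs) U"
      unfolding marked_pairs_def by (intro Collect_cong iff_exI) auto
    then show ?thesis by (simp add: connects_def W_def z_def placed_def)
  qed
  have mark: "(\<lambda>U. U (p, q)) \<in> borel_measurable (mark_space n)" if "p \<in> W" "q \<in> W" for p q
    using that W(2) by (intro measurable_mark) auto
  show "Measurable.pred (mark_space n) (\<lambda>U. connects \<phi> n J xs x U)"
    unfolding conn
    by (rule measurable_rcm_component[of \<phi> "\<lambda>_. z xs" _ W "\<lambda>U. U" 0])
       (auto intro: mark W(1) simp: \<phi>_sym)
  have "(\<lambda>p. z (fst p) i) \<in> borel_measurable (Leb {1..n} \<Otimes>\<^sub>M mark_space n)" for i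
    unfolding z_def by (intro measurable_compose[OF measurable_fst] measurable_placed)
  moreover have "(\<lambda>r. snd r (p, q)) \<in> borel_measurable (Leb {1..n} \<Otimes>\<^sub>M mark_space n)"
    if "p \<in> W" "q \<in> W" for p q
    by (rule measurable_compose[OF measurable_snd mark[OF that]])
  ultimately show "Measurable.pred (Leb {1..n} \<Otimes>\<^sub>M mark_space n) (\<lambda>(xs, U). connects \<phi> n J xs x U)"
    unfolding conn split_def
    by (intro measurable_rcm_component[of \<phi> "\<lambda>p. z (fst p)" _ W snd 0] W(1) \<phi>_measurable \<phi>_sym)
qed

lemma sigma_finite_mark_space: "sigma_finite_measure (mark_space n)"
proof -
  have "prob_space (mark_space n)"
    unfolding mark_space_def by (intro prob_space_PiM prob_space_uniform01)
  then show ?thesis by (intro finite_measure.sigma_finite_measure prob_space.finite_measure)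
qed

lemma alternating_connects_expectation:
  assumes "inj_on (pts n xs x) {0..n+1} \<or> x = 0 \<and> \<phi> 0 = 1"
  shows "(\<integral>U. (\<Sum>J\<in>Pow {1..n}. (-1) ^ (n - card J) * of_bool (connects \<phi> n J xs x U)) \<partial>mark_space n) =
    graph_sum False {1..n} 0 (n+1) (edge_weight \<phi> (pts n xs x))"
proof -
  have "(\<integral>U. (\<Sum>J\<in>Pow {1..n}. (-1) ^ (n - card J) * of_bool (connects \<phi> n J xs x U)) \<partial>mark_space n) =
    (\<integral>U. real_of_int (pi_on {1..n} 0 (n+1) (random_graph n (pts n xs x) U)) \<partial>mark_space n)"
  proof (rule integral_cong_AE)
    show "(\<lambda>U. \<Sum>J\<in>Pow {1..n}. (-1) ^ (n - card J) * of_bool (connects \<phi> n J xs x U) :: real)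
        \<in> borel_measurable (mark_space n)"
    proof (intro borel_measurable_sum borel_measurable_times borel_measurable_const)
      fix J assume "J \<in> Pow {1..n}"
      then have [measurable]: "Measurable.pred (mark_space n) (\<lambda>U. connects \<phi> n J xs x U)"
        using measurable_connects(2) by simp
      show "(\<lambda>U. of_bool (connects \<phi> n J xs x U) :: real) \<in> borel_measurable (mark_space n)"
        by measurable
    qed
    show "(\<lambda>U. real_of_int (pi_on {1..n} 0 (n+1) (random_graph n (pts n xs x) U))) \<in> borel_measurable (mark_space n)"
      using expectation_pi_on(1) by (rule borel_measurable_integrable)
    show "AE U in mark_space n. (\<Sum>J\<in>Pow {1..n}. (-1) ^ (n - card J) * of_bool (connects \<phi> n J xs x U)) =
      real_of_int (pi_on {1..n} 0 (n+1) (random_graph n (pts n xs x) U))"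
      using AE_marks
    proof (rule eventually_mono)
      fix U :: "nat \<times> nat \<Rightarrow> real"
      assume U: "\<forall>p q. p \<le> n + 1 \<longrightarrow> q \<le> n + 1 \<longrightarrow> 0 \<le> U (p, q) \<and> U (p, q) \<le> 1"
      have "connects \<phi> n J xs x U \<longleftrightarrow> reach (random_graph n (pts n xs x) U) (J \<union> {0, n+1}) 0 (n+1)"
        if "J \<in> Pow {1..n}" for J
        using connects_iff_reach[of n U J xs x] U that assms by simp
      then show "(\<Sum>J\<in>Pow {1..n}. (-1) ^ (n - card J) * of_bool (connects \<phi> n J xs x U)) =
        real_of_int (pi_on {1..n} 0 (n+1) (random_graph n (pts n xs x) U))"
        unfolding pi_on_def of_int_sum by (intro sum.cong refl) simp
    qed
  qed
  then show ?thesis by (simp only: expectation_pi_on(2))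
qed

lemma graph_coeff_pts: "graph_coeff np n x = (\<integral>xs. graph_sum np {1..n} 0 (n+1) (edge_weight \<phi> (pts n xs x)) \<partial>Leb {1..n})"
  unfolding graph_coeff_def graph_integral_def
  by (intro Bochner_Integration.integral_cong refl graph_sum_cong edge_weight_cong[of _ "{1..n} \<union> {0, n+1}"])
     (auto simp: pts_def placed_def)

text \<open>
  The graph expansion of \<open>p\<^sub>n\<close>. Configurations with coinciding points are a null set; equality
  outside it suffices because both integrands are measurable.
\<close>
lemma p_coeff_eq_graph_coeff:
  assumes x: "x \<noteq> 0 \<or> \<phi> 0 = 1"
  shows "p_coeff \<phi> n x = 1 / fact n * graph_coeff False n x"
proof -
  have good: "AE xs in Leb {1..n}. inj_on (pts n xs x) {0..n+1} \<or> x = 0 \<and> \<phi> 0 = 1"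
    using AE_pts_inj[of x n] x by (cases "x = 0") (auto elim: eventually_mono)
  let ?F = "\<lambda>n xs U. \<Sum>J\<in>Pow {1..n}. (-1) ^ (n - card J) * of_bool (connects \<phi> n J xs x U) :: real"
  have main: "(\<integral>xs. (\<integral>U. ?F n xs U \<partial>mark_space n) \<partial>Leb {1..n}) = graph_coeff False n x"
    unfolding graph_coeff_pts
  proof (rule integral_cong_AE)
    interpret sigma_finite_measure "mark_space n" by (rule sigma_finite_mark_space)
    show "(\<lambda>xs. \<integral>U. ?F n xs U \<partial>mark_space n) \<in> borel_measurable (Leb {1..n})"
    proof (rule borel_measurable_lebesgue_integral, unfold split_def,
        intro borel_measurable_sum borel_measurable_times borel_measurable_const)
      fix J assume "J \<in> Pow {1..n}"
      then have [measurable]: "Measurable.pred (Leb {1..n} \<Otimes>\<^sub>M mark_space n) (\<lambda>p. connects \<phi> n J (fst p) x (snd p))"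
        using measurable_connects(1)[of J n x] by (simp add: split_def)
      show "(\<lambda>p. of_bool (connects \<phi> n J (fst p) x (snd p)) :: real) \<in> borel_measurable (Leb {1..n} \<Otimes>\<^sub>M mark_space n)"
        by measurable
    qed
    have "(\<lambda>xs. graph_sum False {1..n} 0 (n+1) (edge_weight \<phi> (placed {1..n} (\<lambda>i. if i = 0 then 0 else x) xs))) \<in> borel_measurable (Leb {1..n})"
      by (intro measurable_graph_sum measurable_placed)
    also have "(\<lambda>xs. graph_sum False {1..n} 0 (n+1) (edge_weight \<phi> (placed {1..n} (\<lambda>i. if i = 0 then 0 else x) xs))) =
       (\<lambda>xs. graph_sum False {1..n} 0 (n+1) (edge_weight \<phi> (pts n xs x)))"
      by (intro ext graph_sum_cong edge_weight_cong[of _ "{1..n} \<union> {0, n+1}"]) (auto simp: pts_def placed_def)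
    finally show "(\<lambda>xs. graph_sum False {1..n} 0 (n+1) (edge_weight \<phi> (pts n xs x))) \<in> borel_measurable (Leb {1..n})" .
    show "AE xs in Leb {1..n}. (\<integral>U. ?F n xs U \<partial>mark_space n) = graph_sum False {1..n} 0 (n+1) (edge_weight \<phi> (pts n xs x))"
      using good by (rule eventually_mono) (rule alternating_connects_expectation)
  qed
  \<comment> \<open>For \<open>n = 0\<close> the coefficient is a probability and there is no integral over positions.\<close>
  show ?thesis
  proof (cases "n = 0")
    case True
    have inj: "inj_on (pts 0 xs x) {0..0+1} \<or> x = 0 \<and> \<phi> 0 = 1" for xs
      using x by (auto simp: inj_on_def pts_def)
    have "P0 \<phi> x = (\<integral>U. indicator {U. connects \<phi> 0 {} (\<lambda>_. 0) x U} U \<partial>mark_space 0)"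
      by (simp add: P0_def Int_def conj_commute)
    also have "\<dots> = (\<integral>U. ?F 0 (\<lambda>_. 0) U \<partial>mark_space 0)"
      by (intro Bochner_Integration.integral_cong refl) (simp add: indicator_def)
    also have "\<dots> = graph_sum False {1..0} 0 (0+1) (edge_weight \<phi> (pts 0 (\<lambda>_. 0) x))"
      by (rule alternating_connects_expectation[OF inj])
    also have "\<dots> = graph_coeff False 0 x"
    proof -
      let ?c = "graph_sum False {1..0} 0 (0+1) (edge_weight \<phi> (pts 0 (\<lambda>_. 0) x))"
      have "graph_coeff False 0 x = (\<integral>xs. ?c \<partial>(Leb {1..0} :: (nat \<Rightarrow> real ^ 'd::{finite,linorder}) measure))"
        unfolding graph_coeff_pts
        by (intro Bochner_Integration.integral_cong refl graph_sum_cong edge_weight_cong[of _ "{1..0} \<union> {0, 0+1}"])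
           (auto simp: pts_def)
      also have "\<dots> = ?c"
        by (simp add: PiM_empty measure_def)
      finally show ?thesis by simp
    qed
    finally show ?thesis using True by (simp add: p_coeff_def)
  next
    case False
    then show ?thesis unfolding p_coeff_def using main by simp
  qed
qed

end

section \<open>The coefficients of the expansion of Q\<close>
lemma connected_within_iff_reach:
  "connected_within E I i j \<longleftrightarrow> reach E (I \<union> {i, j}) i j"
  unfolding connected_within_def
  using is_path_imp_reach[of E i _ j "I \<union> {i, j}"] reach_imp_is_path[of E "I \<union> {i, j}" i j] by auto

lemma pi_coeff_eq_pi_on: "pi_coeff n G = pi_on {1..n} 0 (n+1) G"
  by (simp add: pi_coeff_def pi_on_def connected_within_iff_reach)

lemma conn_graphs_iff:
  "E \<in> conn_graphs n \<longleftrightarrow> E \<subseteq> edges_on {0..n+1} \<and> (\<forall>i\<in>{0..n+1}. \<forall>j\<in>{0..n+1}. reach E UNIV i j)"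
proof -
  have "(\<exists>p. is_path E i p j) \<longleftrightarrow> reach E UNIV i j" for i j
    using is_path_imp_reach[of E i _ j UNIV] reach_imp_is_path[of E UNIV i j] by auto
  then show ?thesis by (simp add: conn_graphs_def edges_on_def)
qed

text \<open>
  Connectedness to \<open>0\<close> suffices. Together with the vanishing of \<open>\<pi>\<close> and \<open>\<kappa>\<close> on all other graphs this
  allows to pass between sums over connected graphs and sums over all graphs.
\<close>
lemma conn_graphsI:
  assumes E: "E \<subseteq> edges_on {0..n+1}"
    and "\<And>u. u \<in> insert (n+1) {1..n} \<Longrightarrow> reach E ({1..n} \<union> {0, n+1}) 0 u"
  shows "E \<in> conn_graphs n"
proof -
  have "reach E UNIV 0 i" if "i \<in> {0..n+1}" for i
  proof (cases "i = 0")
    case False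
    then have "i \<in> insert (n+1) {1..n}" using that by auto
    from assms(2)[OF this] show ?thesis by (rule reach_mono) auto
  qed simp
  then show ?thesis
    unfolding conn_graphs_iff using E by (blast intro: reach_trans reach_sym)
qed

lemma kappa_coeff_eq_kappa_on:
  assumes "H \<subseteq> edges_on {0..n+1}"
  shows "kappa_coeff n H = kappa_on {1..n} 0 (n+1) H"
  unfolding kappa_coeff_def kappa_on_def pi_coeff_eq_pi_on
proof (rule sum.mono_neutral_left)
  show "finite (Pow H)" using finite_subset[OF assms finite_edges_on] by simp
  show "\<forall>G\<in>Pow H - {G \<in> conn_graphs n. G \<subseteq> H}.
      pi_on {1..n} 0 (n+1) G * (-1) ^ (card H - card G) = 0"
  proof
    fix G assume "G \<in> Pow H - {G \<in> conn_graphs n. G \<subseteq> H}"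
    then have G: "G \<subseteq> H" "G \<notin> conn_graphs n" by auto
    have "pi_on {1..n} 0 (n+1) G = 0"
    proof (rule ccontr)
      assume nz: "pi_on {1..n} 0 (n+1) G \<noteq> 0"
      have "G \<in> conn_graphs n"
        by (rule conn_graphsI) (use G(1) assms pi_on_nonzero_connected[OF _ nz] in auto)
      with G show False by simp
    qed
    then show "pi_on {1..n} 0 (n+1) G * (-1) ^ (card H - card G) = 0" by simp
  qed
qed auto

lemma not_pivotal_iff:
  assumes G: "G \<subseteq> edges_on {0..n+1}"
  shows "(\<nexists>i. pivotal n G i) \<longleftrightarrow> no_pivotal {1..n} 0 (n+1) G"
proof -
  have W: "{1..n} \<union> {0, n+1} = {0..n+1}" by auto
  have "(\<forall>p. is_path G 0 p (n+1) \<longrightarrow> i \<in> set p) \<longleftrightarrow> \<not> reach G ({0..n+1} - {i}) 0 (n+1)"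
    if i: "i \<in> {1..n}" for i
  proof -
    have "(\<forall>p. is_path G 0 p (n+1) \<longrightarrow> i \<in> set p) \<longleftrightarrow> \<not> reach G (UNIV - {i}) 0 (n+1)"
      using is_path_imp_reach[of G 0 _ "n+1" "UNIV - {i}"]
        reach_imp_is_path[of G "UNIV - {i}" 0 "n+1"] i by fastforce
    also have "reach G (UNIV - {i}) 0 (n+1) \<longleftrightarrow> reach G ({0..n+1} - {i}) 0 (n+1)"
    proof
      assume "reach G (UNIV - {i}) 0 (n+1)"
      then have "n + 1 \<in> {0..n+1} \<and> reach G ((UNIV - {i}) \<inter> {0..n+1}) 0 (n+1)"
      proof (rule reach_closed)
        fix x y assume xy: "{x, y} \<in> G"
        then have "{x, y} \<in> edges_on {0..n+1}" using G by (rule subsetD[rotated])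
        then show "y \<in> {0..n+1} \<and> {x, y} \<in> G" using xy by (simp add: doubleton_edges_on)
      qed simp
      then show "reach G ({0..n+1} - {i}) 0 (n+1)"
        by (elim conjE reach_mono) auto
    next
      assume "reach G ({0..n+1} - {i}) 0 (n+1)"
      then show "reach G (UNIV - {i}) 0 (n+1)" by (rule reach_mono) auto
    qed
    finally show ?thesis .
  qed
  then show ?thesis unfolding no_pivotal_def W pivotal_def by blast
qed

text \<open>
  The formulas for the coefficients may fail at the origin. In the convolution at \<open>x\<close> this
  concerns only the two points \<open>y = 0\<close> and \<open>y = x\<close>, a null set.
\<close>
lemma convolution_coeffs:
  assumes "\<And>y. y \<noteq> 0 \<Longrightarrow> f y = c * F y" "\<And>y. y \<noteq> 0 \<Longrightarrow> g y = d * G y"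
  shows "convolution f g x = c * d * convolution F G x"
proof -
  have "convolution f g x = (\<integral>y. (c * d) * (F (x - y) * G y) \<partial>lborel)"
    unfolding convolution_def
    by (rule integral_discrete_difference[where X = "{0, x}"]) (auto simp: assms)
  then show ?thesis by (simp add: convolution_def)
qed

context rcm_function
begin

lemma graph_coeff_True_0: "graph_coeff True 0 x = graph_coeff False 0 x"
  by (simp add: graph_coeff_def graph_integral_def graph_sum_def no_pivotal_def)

text \<open>
  Both sequences satisfy the same recursion, since
  \<open>(m + 1) (m choose j) / (m + 1)! = 1 / (j! (m - j)!)\<close>.
\<close>
lemma q_coeff_eq_graph_coeff:
  "x \<noteq> 0 \<or> \<phi> 0 = 1 \<Longrightarrow> q_coeff \<phi> n x = 1 / fact n * graph_coeff True n x"
proof (induction n arbitrary: x rule: less_induct)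
  case (less n)
  show ?case
  proof (cases n)
    case 0
    then show ?thesis using p_coeff_eq_graph_coeff[OF less.prems, of 0] by (simp add: graph_coeff_True_0)
  next
    case (Suc m)
    let ?C = "\<lambda>j. convolution (graph_coeff True (m - j)) (graph_coeff False j) x"
    have conv: "convolution (q_coeff \<phi> (m - j)) (p_coeff \<phi> j) x =
        1 / fact (m - j) * (1 / fact j) * ?C j" for j
      by (rule convolution_coeffs) (use less.IH[of "m - j"] p_coeff_eq_graph_coeff Suc in auto)
    have "(\<Sum>k=1..Suc m. convolution (q_coeff \<phi> (Suc m - k)) (p_coeff \<phi> (k - 1)) x) =
      (\<Sum>j\<le>m. convolution (q_coeff \<phi> (m - j)) (p_coeff \<phi> j) x)"
      by (rule sum.reindex_bij_witness[of _ Suc "\<lambda>k. k - 1"]) auto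
    also have "\<dots> = (\<Sum>j\<le>m. 1 / fact (Suc m) * (real (Suc m) * of_nat (m choose j) * ?C j))"
    proof (intro sum.cong refl)
      fix j assume "j \<in> {..m}"
      then have "real (m choose j) = fact m / (fact j * fact (m - j))" by (simp add: binomial_fact)
      then show "convolution (q_coeff \<phi> (m - j)) (p_coeff \<phi> j) x =
          1 / fact (Suc m) * (real (Suc m) * of_nat (m choose j) * ?C j)"
        unfolding conv by (simp add: field_simps del: of_nat_Suc)
    qed
    also have "\<dots> = 1 / fact (Suc m) * (\<Sum>j\<le>m. real (Suc m) * of_nat (m choose j) * ?C j)"
      by (simp only: sum_distrib_left)
    finally have "q_coeff \<phi> (Suc m) x = 1 / fact (Suc m) *
        (graph_coeff False (Suc m) x - (\<Sum>j\<le>m. real (Suc m) * of_nat (m choose j) * ?C j))"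
      using p_coeff_eq_graph_coeff[OF less.prems, of "Suc m"] by (simp only: q_coeff.simps right_diff_distrib)
    then show ?thesis using graph_coeff_decompose[of m x] Suc by simp
  qed
qed

lemma J_int_eq:
  assumes H: "H \<subseteq> edges_on {0..n+1}"
  shows "J_int \<phi> n H x = (\<integral>xs. (\<Prod>e\<in>H. edge_weight \<phi> (placed {1..n} (\<lambda>i. if i = 0 then 0 else x) xs) e) \<partial>Leb {1..n})"
  unfolding J_int_def
proof (intro Bochner_Integration.integral_cong refl)
  fix xs
  let ?z = "placed {1..n} (\<lambda>i. if i = 0 then 0 else x) xs"
  have bij: "bij_betw (\<lambda>(i, j). {i, j}) {(i, j). i < j \<and> {i, j} \<in> H} H"
  proof (rule bij_betwI')
    fix e assume e: "e \<in> H"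
    then obtain i j where "e = {i, j}" "i \<noteq> j" using H by (blast elim: edges_onE)
    then have "e = {min i j, max i j}" "min i j < max i j" by (auto simp: min_def max_def)
    then show "\<exists>p\<in>{(i, j). i < j \<and> {i, j} \<in> H}. e = (case p of (i, j) \<Rightarrow> {i, j})"
      using e by (intro bexI[of _ "(min i j, max i j)"]) auto
  qed (auto simp: doubleton_eq_iff)
  have "(\<Prod>(i, j)\<in>{(i, j). i < j \<and> {i, j} \<in> H}. \<phi> (pts n xs x i - pts n xs x j)) =
      (\<Prod>p\<in>{(i, j). i < j \<and> {i, j} \<in> H}. edge_weight \<phi> ?z (case p of (i, j) \<Rightarrow> {i, j}))"
  proof (intro prod.cong refl)
    fix p assume "p \<in> {(i, j). i < j \<and> {i, j} \<in> H}"
    then obtain i j where p: "p = (i, j)" "{i, j} \<in> H" by auto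
    then have "{i, j} \<in> edges_on {0..n+1}" using H by auto
    then have "pts n xs x i = ?z i" "pts n xs x j = ?z j" by (auto simp: doubleton_edges_on pts_eq_placed)
    then show "(case p of (i, j) \<Rightarrow> \<phi> (pts n xs x i - pts n xs x j)) = edge_weight \<phi> ?z (case p of (i, j) \<Rightarrow> {i, j})"
      using p by (simp add: edge_weight_pair)
  qed
  also have "\<dots> = (\<Prod>e\<in>H. edge_weight \<phi> ?z e)"
    by (rule prod.reindex_bij_betw[OF bij])
  finally show "(\<Prod>(i, j)\<in>{(i, j). i < j \<and> {i, j} \<in> H}. \<phi> (pts n xs x i - pts n xs x j)) =
      (\<Prod>e\<in>H. edge_weight \<phi> ?z e)" .
qed

lemma graph_coeff_True_eq_graph_sum:
  "graph_coeff True n x = (\<Sum>H\<in>conn_graphs_no_pivotal n. real_of_int (kappa_coeff n H) * J_int \<phi> n H x)"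
proof -
  have W: "{1..n} \<union> {0, n+1} = {0..n+1}" by auto
  let ?S = "{H \<in> Pow (edges_on {0..n+1}). no_pivotal {1..n} 0 (n+1) H}"
  have "graph_coeff True n x = (\<Sum>H\<in>?S. \<integral>xs. real_of_int (kappa_on {1..n} 0 (n+1) H) *
      (\<Prod>e\<in>H. edge_weight \<phi> (placed {1..n} (\<lambda>i. if i = 0 then 0 else x) xs) e) \<partial>Leb {1..n})"
    unfolding graph_coeff_def graph_integral_def graph_sum_def W simp_thms
    by (rule Bochner_Integration.integral_sum, rule integrable_graph_sum_term)
       (simp_all only: W mem_Collect_eq Pow_iff, simp_all)
  also have "\<dots> = (\<Sum>H\<in>?S. real_of_int (kappa_coeff n H) * J_int \<phi> n H x)"
    by (intro sum.cong refl) (simp add: kappa_coeff_eq_kappa_on J_int_eq)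
  also have "\<dots> = (\<Sum>H\<in>conn_graphs_no_pivotal n. real_of_int (kappa_coeff n H) * J_int \<phi> n H x)"
  proof (rule sum.mono_neutral_right)
    show "finite ?S" by (simp add: finite_edges_on)
    show "conn_graphs_no_pivotal n \<subseteq> ?S"
      using not_pivotal_iff by (auto simp: conn_graphs_no_pivotal_def conn_graphs_iff)
    show "\<forall>H\<in>?S - conn_graphs_no_pivotal n. real_of_int (kappa_coeff n H) * J_int \<phi> n H x = 0"
    proof
      fix H assume H: "H \<in> ?S - conn_graphs_no_pivotal n"
      then have sub: "H \<subseteq> edges_on {0..n+1}" by simp
      have "kappa_coeff n H = 0"
      proof (rule ccontr)
        assume "kappa_coeff n H \<noteq> 0"
        then have nz: "kappa_on {1..n} 0 (n+1) H \<noteq> 0" by (simp add: kappa_coeff_eq_kappa_on[OF sub])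
        have "H \<in> conn_graphs n"
          by (rule conn_graphsI[OF sub]) (rule kappa_on_nonzero_connected[OF _ nz], simp_all)
        then show False
          using H not_pivotal_iff[OF sub] by (simp add: conn_graphs_no_pivotal_def)
      qed
      then show "real_of_int (kappa_coeff n H) * J_int \<phi> n H x = 0" by simp
    qed
  qed
  finally show ?thesis .
qed

end

theorem theorem5p1:
  fixes \<phi> :: "real ^ 'd::{finite,linorder} \<Rightarrow> real"
    and n :: nat and x :: "real ^ 'd::{finite,linorder}"
  assumes "\<phi> \<in> borel_measurable borel"
    and "\<And>y. 0 \<le> \<phi> y \<and> \<phi> y \<le> 1"
    and "\<And>y. \<phi> y = \<phi> (- y)"
    and "integrable lborel \<phi>"
    and "0 < (\<integral>y. \<phi> y \<partial>lborel)"
    and "x \<noteq> 0 \<or> \<phi> 0 = 1"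
  shows "q_coeff \<phi> n x =
    1 / fact n * (\<Sum>H\<in>conn_graphs_no_pivotal n. real_of_int (kappa_coeff n H) * J_int \<phi> n H x)"
proof -
  interpret rcm_function \<phi>
    by unfold_locales (use assms(1-4) in \<open>simp_all flip: assms(3)\<close>)
  show ?thesis
    using q_coeff_eq_graph_coeff[OF assms(6)] graph_coeff_True_eq_graph_sum by simp
qed

end
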